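(* Consider a $\phi$-irreducible full-dimensional trans-dimensional MCMC algorithm on $\mathcal{X}=\bigcup_{m\in\mathcal{M}}(\{m\}\times\mathcal{X}_m)$ with stationary distribution $\pi$. Let $D$ be the event that no within-model move is ever accepted. Suppose that $\mathbf{P}[D\mid X_0=(m,x)]=0$ for all $(m,x)\in\mathcal{X}$. Then the algorithm is Harris recurrent.
   Context: Setting: $\mathcal{M}\subseteq\mathbf{N}$ with $|\mathcal{M}|>1$. For each $m\in\mathcal{M}$, $\mathcal{X}_m$ is an open subset of $\mathbf{R}^{d_m}$ and $f_m:\mathcal{X}_m\to(0,\infty)$ satisfies $\int_{\mathcal{X}_m}f_m\,d\lambda_m<\infty$, where $\lambda_m$ is Lebesgue measure on $\mathbf{R}^{d_m}$. Let $p:\mathcal{M}\to(0,1)$ with $\sum_{m\in\mathcal{M}}p(m)=1$. The target distribution $\pi$ on $\mathcal{X}$ is determined by $\pi(\{m\}\times A)=p(m)\int_Af_m\,d\lambda_m/\int_{\mathcal{X}_m}f_m\,d\lambda_m$ for measurable $A\subseteq\mathcal{X}_m$, extended by linearity. Full-dimensional trans-dimensional MCMC: fix $0<a<1$ and an irreducible Markov kernel $R$ on $\mathcal{M}$ with $R(m,m')>0$ if and only if $R(m',m)>0$. At each iteration, from state $(m,x)$: with probability $a$ the chain proposes a between-model move to $(m',x')$, with $m'\sim R(m,\cdot)$ and $x'\in\mathcal{X}_{m'}$ generated by some dimension-matching scheme, and accepts or rejects it according to a Metropolis–Hastings acceptance probability (including the appropriate Jacobian factor) which makes $\pi$ stationary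 for this step; the details of this scheme are otherwise arbitrary. With probability $1-a$ the chain leaves $m$ fixed and performs a within-model move: it proposes to replace $x$ by $y\in\mathcal{X}_m$ drawn from a density $q_m(x,\cdot)$ with respect to $\lambda_m$ on $\mathcal{X}_m$ ($q_m$ jointly measurable, nonnegative, integrating to $1$ in $y$), and accepts with probability $\min\left[1,\frac{f_m(y)q_m(y,x)}{f_m(x)q_m(x,y)}\right]$ (equal to $1$ if the denominator is $0$), otherwise staying at $(m,x)$. For measurable $A$, $\tau_A=\inf\{n\ge1:X_n\in A\}$ ($\infty$ if never). A chain is $\phi$-irreducible if there is a nonzero $\sigma$-finite measure $\psi$ on $\mathcal{X}$ with $\mathbf{P}[\tau_A<\infty\mid X_0=z]>0$ for all $z\in\mathcal{X}$ and all measurable $A$ with $\psi(A)>0$. A $\phi$-irreducible chain with stationary distribution $\pi$ is Harris recurrent if $\mathbf{P}(\tau_A<\infty\mid X_0=z)=1$ for all measurable $A$ with $\pi(A)>0$ and all $z\in\mathcal{X}$. *)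

theory Defs
  imports "HOL-Probability.Probability"
begin

section \<open>Markov chains on a measurable space\<close>

text \<open>
  A Markov kernel on \<open>S\<close> is a function \<open>K \<in> S \<rightarrow>\<^sub>M prob_algebra S\<close>. The law of the chain started
  at \<open>z\<close> is the Ionescu-Tulcea measure on the space of trajectories \<open>\<omega> :: nat \<Rightarrow> 'a\<close>.
\<close>

definition chain_law :: "'a measure \<Rightarrow> ('a \<Rightarrow> 'a measure) \<Rightarrow> 'a \<Rightarrow> (nat \<Rightarrow> 'a) measure" where
  "chain_law S K z =
     projective_family.lim UNIV
       (Ionescu_Tulcea.CI (\<lambda>n \<omega>. if n = 0 then return S z else K (\<omega> (n - 1))) (\<lambda>_. S))
       (\<lambda>_. S)"

definition hitting_time :: "'a set \<Rightarrow> (nat \<Rightarrow> 'a) \<Rightarrow> enat" where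
  "hitting_time A \<omega> = (INF n\<in>{n. n \<ge> 1 \<and> \<omega> n \<in> A}. enat n)"

definition phi_irreducible :: "'a measure \<Rightarrow> ('a \<Rightarrow> 'a measure) \<Rightarrow> bool" where
  "phi_irreducible S K \<longleftrightarrow>
     (\<exists>\<psi>. sigma_finite_measure \<psi> \<and> sets \<psi> = sets S \<and> emeasure \<psi> (space S) \<noteq> 0 \<and>
        (\<forall>z\<in>space S. \<forall>A\<in>sets S. emeasure \<psi> A > 0 \<longrightarrow>
           \<P>(\<omega> in chain_law S K z. hitting_time A \<omega> < \<infinity>) > 0))"

definition stationary :: "'a measure \<Rightarrow> ('a \<Rightarrow> 'a measure) \<Rightarrow> 'a measure \<Rightarrow> bool" where
  "stationary S K \<pi> \<longleftrightarrow>
     prob_space \<pi> \<and> sets \<pi> = sets S \<and>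
     (\<forall>A\<in>sets S. (\<integral>\<^sup>+z. emeasure (K z) A \<partial>\<pi>) = emeasure \<pi> A)"

definition harris_recurrent :: "'a measure \<Rightarrow> ('a \<Rightarrow> 'a measure) \<Rightarrow> 'a measure \<Rightarrow> bool" where
  "harris_recurrent S K \<pi> \<longleftrightarrow>
     phi_irreducible S K \<and> stationary S K \<pi> \<and>
     (\<forall>A\<in>sets S. emeasure \<pi> A > 0 \<longrightarrow>
        (\<forall>z\<in>space S. \<P>(\<omega> in chain_law S K z. hitting_time A \<omega> < \<infinity>) = 1))"


section \<open>Full-dimensional trans-dimensional MCMC\<close>

text \<open>
  Since the dimension varies with the model, a point of \<open>\<real>\<^sup>d\<close> is a function \<open>nat \<Rightarrow> real\<close> in
  \<open>PiE {..<d} (\<lambda>_. UNIV)\<close>, i.e. with the value \<open>undefined\<close> outside \<open>{..<d}\<close>.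
\<close>

type_synonym point = "nat \<Rightarrow> real"
type_synonym state = "nat \<times> point"

text \<open>
  The between-model proposal is a joint law of the proposed state and of an auxiliary value in
  \<open>aux_space\<close>. The latter carries whatever further random variables a dimension-matching scheme
  uses and its Metropolis-Hastings ratio (with Jacobian) depends on; the acceptance probability is
  a function of the current state, the proposed state and this value.
\<close>

record 'u trans_dim_mcmc =
  models :: "nat set"
  param_dim :: "nat \<Rightarrow> nat"
  param_region :: "nat \<Rightarrow> point set"
  unnorm_density :: "nat \<Rightarrow> point \<Rightarrow> real"
  model_weight :: "nat \<Rightarrow> real"
  between_prob :: real
  model_proposal :: "nat \<Rightarrow> nat pmf"
  aux_space :: "'u measure"
  between_proposal :: "state \<Rightarrow> (state \<times> 'u) measure"
  between_accept :: "state \<Rightarrow> state \<times> 'u \<Rightarrow> real"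
  within_proposal :: "nat \<Rightarrow> point \<Rightarrow> point \<Rightarrow> real"

text \<open>Lebesgue measure on \<open>\<X>\<^sub>m\<close>, with its Borel sets.\<close>

definition region_lebesgue :: "'u trans_dim_mcmc \<Rightarrow> nat \<Rightarrow> point measure" where
  "region_lebesgue \<A> m =
     restrict_space (Pi\<^sub>M {..<param_dim \<A> m} (\<lambda>_. lborel)) (param_region \<A> m)"

definition state_space :: "'u trans_dim_mcmc \<Rightarrow> state measure" where
  "state_space \<A> =
     sigma (SIGMA m:models \<A>. param_region \<A> m)
       (\<Union>m\<in>models \<A>. (\<lambda>B. {m} \<times> B) ` sets (region_lebesgue \<A> m))"

text \<open>Each slice \<open>Pair m -` E\<close> is implicitly intersected with \<open>\<X>\<^sub>m\<close>, the space of the measure.\<close>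

definition target :: "'u trans_dim_mcmc \<Rightarrow> state measure" where
  "target \<A> =
     measure_of (space (state_space \<A>)) (sets (state_space \<A>))
       (\<lambda>E. \<integral>\<^sup>+m. ennreal (model_weight \<A> m) *
              (\<integral>\<^sup>+x\<in>Pair m -` E. ennreal (unnorm_density \<A> m x) \<partial>region_lebesgue \<A> m) /
              (\<integral>\<^sup>+x. ennreal (unnorm_density \<A> m x) \<partial>region_lebesgue \<A> m)
            \<partial>count_space (models \<A>))"

text \<open>The between-model step on its own (propose, then accept or stay).\<close>

definition between_step :: "'u trans_dim_mcmc \<Rightarrow> state \<Rightarrow> state measure" where
  "between_step \<A> z =
     between_proposal \<A> z \<bind> (\<lambda>w.
       measure_pmf (bernoulli_pmf (between_accept \<A> z w)) \<bind> (\<lambda>b.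
         return (state_space \<A>) (if b then fst w else z)))"

definition within_accept :: "'u trans_dim_mcmc \<Rightarrow> nat \<Rightarrow> point \<Rightarrow> point \<Rightarrow> real" where
  "within_accept \<A> m x y =
     (let num = unnorm_density \<A> m y * within_proposal \<A> m y x;
          den = unnorm_density \<A> m x * within_proposal \<A> m x y
      in if den = 0 then 1 else min 1 (num / den))"

text \<open>
  Steps of the algorithm are recorded together with a flag telling whether the step was an accepted
  within-model move. The flag cannot be read off from the trajectory in the state space, because
  between-model moves may also change \<open>x\<close> without changing \<open>m\<close>.
\<close>

abbreviation flagged_space :: "'u trans_dim_mcmc \<Rightarrow> (state \<times> bool) measure" where
  "flagged_space \<A> \<equiv> state_space \<A> \<Otimes>\<^sub>M count_space UNIV"

definition within_step :: "'u trans_dim_mcmc \<Rightarrow> state \<Rightarrow> (state \<times> bool) measure" where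
  "within_step \<A> = (\<lambda>(m, x).
     density (region_lebesgue \<A> m) (\<lambda>y. ennreal (within_proposal \<A> m x y)) \<bind> (\<lambda>y.
       measure_pmf (bernoulli_pmf (within_accept \<A> m x y)) \<bind> (\<lambda>b.
         return (flagged_space \<A>) (if b then ((m, y), True) else ((m, x), False)))))"

definition flagged_step :: "'u trans_dim_mcmc \<Rightarrow> state \<Rightarrow> (state \<times> bool) measure" where
  "flagged_step \<A> z =
     measure_pmf (bernoulli_pmf (between_prob \<A>)) \<bind> (\<lambda>b.
       if b then distr (between_step \<A> z) (flagged_space \<A>) (\<lambda>z'. (z', False))
       else within_step \<A> z)"

definition mcmc_kernel :: "'u trans_dim_mcmc \<Rightarrow> state \<Rightarrow> state measure" where
  "mcmc_kernel \<A> z = distr (flagged_step \<A> z) (state_space \<A>) fst"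

text \<open>
  Law of the sequence of states and flags from \<open>X\<^sub>0 = z\<close>; the flag at time \<open>n \<ge> 1\<close> belongs to the
  \<open>n\<close>-th step, the one at time \<open>0\<close> is meaningless.
\<close>

definition flagged_law :: "'u trans_dim_mcmc \<Rightarrow> state \<Rightarrow> (nat \<Rightarrow> state \<times> bool) measure" where
  "flagged_law \<A> z = chain_law (flagged_space \<A>) (\<lambda>(z', _). flagged_step \<A> z') (z, False)"

definition no_within_move_accepted :: "(nat \<Rightarrow> state \<times> bool) \<Rightarrow> bool" where
  "no_within_move_accepted \<omega> \<longleftrightarrow> (\<forall>n\<ge>1. \<not> snd (\<omega> n))"

locale full_dim_trans_dim_mcmc =
  fixes \<A> :: "'u trans_dim_mcmc"
  assumes several_models: "\<exists>m\<in>models \<A>. \<exists>m'\<in>models \<A>. m \<noteq> m'"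
    and region_open: "\<And>m. m \<in> models \<A> \<Longrightarrow>
      openin (product_topology (\<lambda>_. euclideanreal) {..<param_dim \<A> m}) (param_region \<A> m)"
    and region_nonempty: "\<And>m. m \<in> models \<A> \<Longrightarrow> param_region \<A> m \<noteq> {}"
    and density_measurable: "\<And>m. m \<in> models \<A> \<Longrightarrow>
      unnorm_density \<A> m \<in> borel_measurable (region_lebesgue \<A> m)"
    and density_pos: "\<And>m x. m \<in> models \<A> \<Longrightarrow> x \<in> param_region \<A> m \<Longrightarrow> unnorm_density \<A> m x > 0"
    and density_integral_finite: "\<And>m. m \<in> models \<A> \<Longrightarrow>
      (\<integral>\<^sup>+x. ennreal (unnorm_density \<A> m x) \<partial>region_lebesgue \<A> m) < \<infinity>"
    and weight_bounds: "\<And>m. m \<in> models \<A> \<Longrightarrow> 0 < model_weight \<A> m \<and> model_weight \<A> m < 1"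
    and weight_sum: "(model_weight \<A> has_sum 1) (models \<A>)"
    and between_prob_bounds: "0 < between_prob \<A>" "between_prob \<A> < 1"
    and model_proposal_closed: "\<And>m. m \<in> models \<A> \<Longrightarrow> set_pmf (model_proposal \<A> m) \<subseteq> models \<A>"
    and model_proposal_irreducible: "\<And>m m'. m \<in> models \<A> \<Longrightarrow> m' \<in> models \<A> \<Longrightarrow>
      \<exists>n\<ge>1. pmf (((\<lambda>\<mu>. bind_pmf \<mu> (model_proposal \<A>)) ^^ n) (return_pmf m)) m' > 0"
    and model_proposal_symmetric_support: "\<And>m m'. m \<in> models \<A> \<Longrightarrow> m' \<in> models \<A> \<Longrightarrow>
      pmf (model_proposal \<A> m) m' > 0 \<longleftrightarrow> pmf (model_proposal \<A> m') m > 0"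
    and between_proposal_kernel:
      "between_proposal \<A> \<in> state_space \<A> \<rightarrow>\<^sub>M prob_algebra (state_space \<A> \<Otimes>\<^sub>M aux_space \<A>)"
    and between_proposal_model: "\<And>m x m'. m \<in> models \<A> \<Longrightarrow> x \<in> param_region \<A> m \<Longrightarrow>
      m' \<in> models \<A> \<Longrightarrow>
      \<P>(w in between_proposal \<A> (m, x). fst (fst w) = m') = pmf (model_proposal \<A> m) m'"
    and between_accept_measurable: "(\<lambda>(z, w). between_accept \<A> z w)
      \<in> borel_measurable (state_space \<A> \<Otimes>\<^sub>M (state_space \<A> \<Otimes>\<^sub>M aux_space \<A>))"
    and between_accept_bounds: "\<And>z w. z \<in> space (state_space \<A>) \<Longrightarrow>
      w \<in> space (state_space \<A> \<Otimes>\<^sub>M aux_space \<A>) \<Longrightarrow>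
      0 \<le> between_accept \<A> z w \<and> between_accept \<A> z w \<le> 1"
    and between_step_stationary: "stationary (state_space \<A>) (between_step \<A>) (target \<A>)"
    and within_proposal_measurable: "\<And>m. m \<in> models \<A> \<Longrightarrow>
      (\<lambda>(x, y). within_proposal \<A> m x y)
        \<in> borel_measurable (region_lebesgue \<A> m \<Otimes>\<^sub>M region_lebesgue \<A> m)"
    and within_proposal_nonneg: "\<And>m x y. m \<in> models \<A> \<Longrightarrow> x \<in> param_region \<A> m \<Longrightarrow>
      y \<in> param_region \<A> m \<Longrightarrow> within_proposal \<A> m x y \<ge> 0"
    and within_proposal_integral: "\<And>m x. m \<in> models \<A> \<Longrightarrow> x \<in> param_region \<A> m \<Longrightarrow>
      (\<integral>\<^sup>+y. ennreal (within_proposal \<A> m x y) \<partial>region_lebesgue \<A> m) = 1"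

text \<open>The target measure and the kernels are well-defined, so the chain laws above exist.\<close>


lemma (in full_dim_trans_dim_mcmc) region_sets:
  assumes m: "m \<in> models \<A>"
  shows "param_region \<A> m \<in> sets (Pi\<^sub>M {..<param_dim \<A> m} (\<lambda>_. lborel))"
proof -
  let ?I = "{..<param_dim \<A> m}" and ?X = "param_region \<A> m"
  have sub: "?X \<subseteq> PiE ?I (\<lambda>_. UNIV)"
    using openin_subset[OF region_open[OF m]] by simp
  have "continuous_map (product_topology (\<lambda>_. euclideanreal) UNIV)
          (product_topology (\<lambda>_. euclideanreal) ?I) (\<lambda>x. restrict x ?I)"
    unfolding continuous_map_componentwise by (auto intro: continuous_map_product_projection)
  from openin_continuous_map_preimage[OF this region_open[OF m]]
  have "open {x :: point. restrict x ?I \<in> ?X}"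
    by (simp add: open_fun_def)
  then have B: "{x :: point. restrict x ?I \<in> ?X} \<in> sets (Pi\<^sub>M UNIV (\<lambda>_. borel))"
    by (simp add: sets_PiM_equal_borel)
  have id: "(\<lambda>x. x) \<in> Pi\<^sub>M ?I (\<lambda>_. lborel) \<rightarrow>\<^sub>M Pi\<^sub>M UNIV (\<lambda>_. borel :: real measure)"
  proof (rule measurable_PiM_single')
    fix i :: nat
    show "(\<lambda>x. x i) \<in> Pi\<^sub>M ?I (\<lambda>_. lborel) \<rightarrow>\<^sub>M (borel :: real measure)"
    proof (cases "i \<in> ?I")
      case True
      have "(\<lambda>x. x i) \<in> Pi\<^sub>M ?I (\<lambda>_. lborel) \<rightarrow>\<^sub>M (lborel :: real measure)"
        by (rule measurable_component_singleton[OF True])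
      then show ?thesis by simp
    next
      case False
      have "(\<lambda>x. undefined) \<in> Pi\<^sub>M ?I (\<lambda>_. lborel) \<rightarrow>\<^sub>M (borel :: real measure)"
        by simp
      moreover have "x i = undefined"
        if "x \<in> space (Pi\<^sub>M ?I (\<lambda>_. lborel :: real measure))" for x
        using that False by (auto simp: space_PiM PiE_iff extensional_def)
      ultimately show ?thesis
        by (subst measurable_cong[where g="\<lambda>_. undefined"]) auto
    qed
  qed auto
  have "?X = (\<lambda>x. x) -` {x. restrict x ?I \<in> ?X} \<inter> space (Pi\<^sub>M ?I (\<lambda>_. lborel :: real measure))"
  proof -
    have "restrict x ?I = x" if "x \<in> PiE ?I (\<lambda>_. UNIV)" for x :: point
      using that by (auto simp: PiE_iff extensional_restrict)
    then show ?thesis using sub by (auto simp: space_PiM)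
  qed
  with measurable_sets[OF id B] show ?thesis by simp
qed

lemma (in full_dim_trans_dim_mcmc) space_region_lebesgue:
  "m \<in> models \<A> \<Longrightarrow> space (region_lebesgue \<A> m) = param_region \<A> m"
  using sets.sets_into_space[OF region_sets] by (auto simp: region_lebesgue_def space_restrict_space)

lemma (in full_dim_trans_dim_mcmc) space_state_space:
  "space (state_space \<A>) = (SIGMA m:models \<A>. param_region \<A> m)"
  unfolding state_space_def
  by (rule space_measure_of)
     (use sets.sets_into_space space_region_lebesgue in blast)

lemma (in full_dim_trans_dim_mcmc) sets_state_space_gen:
  "sets (state_space \<A>) = sigma_sets (SIGMA m:models \<A>. param_region \<A> m)
     (\<Union>m\<in>models \<A>. (\<lambda>B. {m} \<times> B) ` sets (region_lebesgue \<A> m))"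
  unfolding state_space_def
  by (rule sets_measure_of)
     (use sets.sets_into_space space_region_lebesgue in blast)

lemma (in full_dim_trans_dim_mcmc) measurable_Pair_model:
  assumes m: "m \<in> models \<A>"
  shows "Pair m \<in> region_lebesgue \<A> m \<rightarrow>\<^sub>M state_space \<A>"
  unfolding state_space_def
proof (rule measurable_measure_of)
  show "(\<Union>m\<in>models \<A>. (\<lambda>B. {m} \<times> B) ` sets (region_lebesgue \<A> m)) \<subseteq>
      Pow (SIGMA m:models \<A>. param_region \<A> m)"
    using sets.sets_into_space space_region_lebesgue by blast
  show "Pair m \<in> space (region_lebesgue \<A> m) \<rightarrow> (SIGMA m:models \<A>. param_region \<A> m)"
    using m by (auto simp: space_region_lebesgue)
  fix y assume "y \<in> (\<Union>m\<in>models \<A>. (\<lambda>B. {m} \<times> B) ` sets (region_lebesgue \<A> m))"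
  then obtain m' B where y: "m' \<in> models \<A>" "B \<in> sets (region_lebesgue \<A> m')" "y = {m'} \<times> B"
    by auto
  have "Pair m -` y \<inter> space (region_lebesgue \<A> m) = (if m = m' then B else {})"
    using y sets.sets_into_space[OF y(2)] by auto
  then show "Pair m -` y \<inter> space (region_lebesgue \<A> m) \<in> sets (region_lebesgue \<A> m)"
    using y by auto
qed

lemma (in full_dim_trans_dim_mcmc) measurable_from_state_space:
  assumes "\<And>m. m \<in> models \<A> \<Longrightarrow> (\<lambda>x. g (m, x)) \<in> region_lebesgue \<A> m \<rightarrow>\<^sub>M N"
  shows "g \<in> state_space \<A> \<rightarrow>\<^sub>M N"
proof (rule measurableI)
  fix z assume "z \<in> space (state_space \<A>)"
  then obtain m x where z: "z = (m, x)" "m \<in> models \<A>" "x \<in> param_region \<A> m"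
    by (auto simp: space_state_space)
  with measurable_space[OF assms, of m x] show "g z \<in> space N"
    by (simp add: space_region_lebesgue)
next
  fix E assume E: "E \<in> sets N"
  have "g -` E \<inter> space (state_space \<A>) =
     (\<Union>m\<in>models \<A>. {m} \<times> ((\<lambda>x. g (m, x)) -` E \<inter> space (region_lebesgue \<A> m)))"
    by (auto simp: space_state_space space_region_lebesgue)
  also have "\<dots> \<in> sets (state_space \<A>)"
  proof (rule sets.countable_UN')
    show "countable (models \<A>)" by simp
    show "(\<lambda>m. {m} \<times> ((\<lambda>x. g (m, x)) -` E \<inter> space (region_lebesgue \<A> m))) ` models \<A>
       \<subseteq> sets (state_space \<A>)"
      using measurable_sets[OF assms E]
      by (auto simp: sets_state_space_gen intro!: sigma_sets.Basic)
  qed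
  finally show "g -` E \<inter> space (state_space \<A>) \<in> sets (state_space \<A>)" .
qed

lemma (in full_dim_trans_dim_mcmc) emeasure_target:
  assumes E: "E \<in> sets (state_space \<A>)"
  shows "emeasure (target \<A>) E =
    (\<integral>\<^sup>+m. ennreal (model_weight \<A> m) *
              (\<integral>\<^sup>+x\<in>Pair m -` E. ennreal (unnorm_density \<A> m x) \<partial>region_lebesgue \<A> m) /
              (\<integral>\<^sup>+x. ennreal (unnorm_density \<A> m x) \<partial>region_lebesgue \<A> m)
            \<partial>count_space (models \<A>))" (is "_ = ?\<mu> E")
proof -
  have sets_slice: "Pair m -` E \<inter> space (region_lebesgue \<A> m) \<in> sets (region_lebesgue \<A> m)"
    if "m \<in> models \<A>" "E \<in> sets (state_space \<A>)" for m E
    using measurable_sets[OF measurable_Pair_model] that by blast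
  let ?D = "\<lambda>m. density (region_lebesgue \<A> m) (\<lambda>x. ennreal (unnorm_density \<A> m x))"
  have slice: "(\<integral>\<^sup>+x\<in>Pair m -` E. ennreal (unnorm_density \<A> m x) \<partial>region_lebesgue \<A> m) =
     emeasure (?D m) (Pair m -` E \<inter> space (region_lebesgue \<A> m))"
    if "m \<in> models \<A>" "E \<in> sets (state_space \<A>)" for m E
    using density_measurable[OF that(1)] sets_slice[OF that]
    by (subst emeasure_density) (auto intro!: nn_integral_cong split: split_indicator)
  have "countably_additive (sets (state_space \<A>)) ?\<mu>"
  proof (rule countably_additiveI)
    fix F :: "nat \<Rightarrow> state set"
    assume F: "range F \<subseteq> sets (state_space \<A>)" "disjoint_family F"
      "(\<Union>i. F i) \<in> sets (state_space \<A>)"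
    have "(\<Sum>i. ?\<mu> (F i)) = (\<integral>\<^sup>+m. (\<Sum>i. ennreal (model_weight \<A> m) *
              (\<integral>\<^sup>+x\<in>Pair m -` F i. ennreal (unnorm_density \<A> m x) \<partial>region_lebesgue \<A> m) /
              (\<integral>\<^sup>+x. ennreal (unnorm_density \<A> m x) \<partial>region_lebesgue \<A> m)) \<partial>count_space (models \<A>))"
      by (rule nn_integral_suminf[symmetric]) simp
    also have "\<dots> = ?\<mu> (\<Union>i. F i)"
    proof (rule nn_integral_cong)
      fix m assume "m \<in> space (count_space (models \<A>))"
      then have m: "m \<in> models \<A>" by simp
      have Fi: "F i \<in> sets (state_space \<A>)" for i using F by auto
      have "(\<Sum>i. emeasure (?D m) (Pair m -` F i \<inter> space (region_lebesgue \<A> m))) =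
          emeasure (?D m) (\<Union>i. Pair m -` F i \<inter> space (region_lebesgue \<A> m))"
        using F by (intro suminf_emeasure)
          (auto simp: disjoint_family_on_def intro!: sets_slice[OF m Fi])
      also have "(\<Union>i. Pair m -` F i \<inter> space (region_lebesgue \<A> m)) =
          Pair m -` (\<Union>i. F i) \<inter> space (region_lebesgue \<A> m)" by auto
      finally show "(\<Sum>i. ennreal (model_weight \<A> m) *
              (\<integral>\<^sup>+x\<in>Pair m -` F i. ennreal (unnorm_density \<A> m x) \<partial>region_lebesgue \<A> m) /
              (\<integral>\<^sup>+x. ennreal (unnorm_density \<A> m x) \<partial>region_lebesgue \<A> m)) =
         ennreal (model_weight \<A> m) *
              (\<integral>\<^sup>+x\<in>Pair m -` (\<Union>i. F i). ennreal (unnorm_density \<A> m x) \<partial>region_lebesgue \<A> m) /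
              (\<integral>\<^sup>+x. ennreal (unnorm_density \<A> m x) \<partial>region_lebesgue \<A> m)"
        by (simp only: slice[OF m Fi] slice[OF m F(3)] divide_ennreal_def
              ennreal_suminf_multc ennreal_suminf_cmult)
    qed
    finally show "(\<Sum>i. ?\<mu> (F i)) = ?\<mu> (\<Union>i. F i)" .
  qed
  moreover have "positive (sets (state_space \<A>)) ?\<mu>" by (simp add: positive_def)
  ultimately show ?thesis
    unfolding target_def
    by (intro emeasure_measure_of_sigma[OF sets.sigma_algebra_axioms _ _ E])
qed


lemma (in full_dim_trans_dim_mcmc) emeasure_target_Times:
  assumes m: "m \<in> models \<A>" and B: "B \<in> sets (region_lebesgue \<A> m)"
  shows "emeasure (target \<A>) ({m} \<times> B) =
    ennreal (model_weight \<A> m) *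
      (\<integral>\<^sup>+x\<in>B. ennreal (unnorm_density \<A> m x) \<partial>region_lebesgue \<A> m) /
      (\<integral>\<^sup>+x. ennreal (unnorm_density \<A> m x) \<partial>region_lebesgue \<A> m)" (is "_ = ?c")
proof -
  have "{m} \<times> B \<in> sets (state_space \<A>)"
    using m B by (auto simp: sets_state_space_gen intro!: sigma_sets.Basic)
  note emeasure_target[OF this]
  also have "(\<integral>\<^sup>+m'. ennreal (model_weight \<A> m') *
      (\<integral>\<^sup>+x\<in>Pair m' -` ({m} \<times> B). ennreal (unnorm_density \<A> m' x) \<partial>region_lebesgue \<A> m') /
      (\<integral>\<^sup>+x. ennreal (unnorm_density \<A> m' x) \<partial>region_lebesgue \<A> m') \<partial>count_space (models \<A>)) =
    (\<integral>\<^sup>+m'. ?c * indicator {m} m' \<partial>count_space (models \<A>))"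
  proof (rule nn_integral_cong)
    fix m'
    have "Pair m' -` ({m} \<times> B) = (if m' = m then B else {})" by auto
    then show "ennreal (model_weight \<A> m') *
      (\<integral>\<^sup>+x\<in>Pair m' -` ({m} \<times> B). ennreal (unnorm_density \<A> m' x) \<partial>region_lebesgue \<A> m') /
      (\<integral>\<^sup>+x. ennreal (unnorm_density \<A> m' x) \<partial>region_lebesgue \<A> m') = ?c * indicator {m} m'"
      by simp
  qed
  also have "\<dots> = ?c"
    using m by (subst nn_integral_cmult_indicator) auto
  finally show ?thesis .
qed

lemma bernoulli_pmf_kernel:
  "(\<lambda>p. measure_pmf (bernoulli_pmf p)) \<in> borel \<rightarrow>\<^sub>M prob_algebra (count_space UNIV)"
proof (rule measurable_prob_algebraI)
  show "(\<lambda>p. measure_pmf (bernoulli_pmf p)) \<in> borel \<rightarrow>\<^sub>M subprob_algebra (count_space UNIV)"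
  proof (rule measurable_subprob_algebra)
    fix A :: "bool set"
    have "emeasure (measure_pmf (bernoulli_pmf p)) A = (\<Sum>b\<in>A. ennreal (pmf (bernoulli_pmf p) b))" for p
      by (simp add: emeasure_measure_pmf_finite)
    moreover have "pmf (bernoulli_pmf p) b = (if b then min 1 (max 0 p) else 1 - min 1 (max 0 p))" for p b
    proof -
      interpret pmf_as_function .
      show ?thesis by transfer simp
    qed
    ultimately show "(\<lambda>p. emeasure (measure_pmf (bernoulli_pmf p)) A) \<in> borel_measurable borel"
      by simp
  qed (auto intro: measure_pmf.subprob_space_axioms)
qed (rule measure_pmf.prob_space_axioms)

lemma (in full_dim_trans_dim_mcmc) between_step_kernel:
  "between_step \<A> \<in> state_space \<A> \<rightarrow>\<^sub>M prob_algebra (state_space \<A>)"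
proof -
  have inner: "(\<lambda>((z, w), b). return (state_space \<A>) (if b then fst w else z))
     \<in> (state_space \<A> \<Otimes>\<^sub>M (state_space \<A> \<Otimes>\<^sub>M aux_space \<A>)) \<Otimes>\<^sub>M count_space UNIV
       \<rightarrow>\<^sub>M prob_algebra (state_space \<A>)"
    unfolding split_beta
    by (rule measurable_compose[OF _ measurable_return_prob_space], rule measurable_If) measurable
  have outer: "(\<lambda>(z, w). measure_pmf (bernoulli_pmf (between_accept \<A> z w)) \<bind> (\<lambda>b.
         return (state_space \<A>) (if b then fst w else z)))
     \<in> state_space \<A> \<Otimes>\<^sub>M (state_space \<A> \<Otimes>\<^sub>M aux_space \<A>) \<rightarrow>\<^sub>M prob_algebra (state_space \<A>)"
    using measurable_bind_prob_space2[OF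
        measurable_compose[OF between_accept_measurable bernoulli_pmf_kernel], 
        where R="state_space \<A>" and g="\<lambda>x b. return (state_space \<A>) (if b then fst (snd x) else fst x)"]
      inner by (simp add: split_beta)
  show ?thesis
    unfolding between_step_def
    by (rule measurable_bind_prob_space2[OF between_proposal_kernel outer])
qed

lemma (in full_dim_trans_dim_mcmc) sigma_finite_region_lebesgue:
  assumes "m \<in> models \<A>" shows "sigma_finite_measure (region_lebesgue \<A> m)"
proof -
  interpret product_sigma_finite "\<lambda>_. lborel :: real measure" ..
  show ?thesis
    unfolding region_lebesgue_def
    using region_sets[OF assms] sigma_finite[of "{..<param_dim \<A> m}"]
    by (intro sigma_finite_measure_restrict_space) auto
qed

lemma (in full_dim_trans_dim_mcmc) within_density_kernel:
  assumes m: "m \<in> models \<A>"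
  shows "(\<lambda>x. density (region_lebesgue \<A> m) (\<lambda>y. ennreal (within_proposal \<A> m x y)))
    \<in> region_lebesgue \<A> m \<rightarrow>\<^sub>M prob_algebra (region_lebesgue \<A> m)" (is "?d \<in> ?L \<rightarrow>\<^sub>M _")
proof -
  interpret sigma_finite_measure "?L" by (rule sigma_finite_region_lebesgue[OF m])
  have q: "(\<lambda>y. ennreal (within_proposal \<A> m x y)) \<in> borel_measurable ?L" if "x \<in> space ?L" for x
    using measurable_Pair2[OF within_proposal_measurable[OF m] that] by simp
  have P: "prob_space (?d x)" if x: "x \<in> space ?L" for x
  proof (rule prob_spaceI)
    have "emeasure (?d x) (space ?L) = (\<integral>\<^sup>+y. ennreal (within_proposal \<A> m x y) \<partial>?L)"
      by (subst emeasure_density[OF q[OF x]]) (auto intro!: nn_integral_cong)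
    then show "emeasure (?d x) (space (?d x)) = 1"
      using within_proposal_integral[OF m, of x] x by (simp add: space_region_lebesgue[OF m])
  qed
  show ?thesis
  proof (rule measurable_prob_algebraI[OF P])
    show "?d \<in> ?L \<rightarrow>\<^sub>M subprob_algebra ?L"
    proof (rule measurable_subprob_algebra)
      show "subprob_space (?d x)" if "x \<in> space ?L" for x
        using P[OF that] by (rule prob_space_imp_subprob_space)
      fix B assume B: "B \<in> sets ?L"
      have "emeasure (?d x) B = (\<integral>\<^sup>+y. ennreal (within_proposal \<A> m x y) * indicator B y \<partial>?L)"
        if "x \<in> space ?L" for x
        by (rule emeasure_density[OF q[OF that] B])
      moreover have "(\<lambda>(x, y). ennreal (within_proposal \<A> m x y) * indicator B y)
          \<in> borel_measurable (?L \<Otimes>\<^sub>M ?L)"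
        using within_proposal_measurable[OF m] B unfolding split_beta by measurable
      ultimately show "(\<lambda>x. emeasure (?d x) B) \<in> borel_measurable ?L"
        using measurable_cong[of ?L "\<lambda>x. emeasure (?d x) B"
            "\<lambda>x. \<integral>\<^sup>+y. ennreal (within_proposal \<A> m x y) * indicator B y \<partial>?L" borel]
          borel_measurable_nn_integral[of "\<lambda>x y. ennreal (within_proposal \<A> m x y) * indicator B y" ?L]
        by blast
    qed simp
  qed simp
qed

lemma (in full_dim_trans_dim_mcmc) within_step_kernel:
  "within_step \<A> \<in> state_space \<A> \<rightarrow>\<^sub>M prob_algebra (flagged_space \<A>)"
proof (rule measurable_from_state_space)
  fix m assume m: "m \<in> models \<A>"
  let ?L = "region_lebesgue \<A> m"
  have q: "(\<lambda>w. within_proposal \<A> m (fst w) (snd w)) \<in> borel_measurable (?L \<Otimes>\<^sub>M ?L)"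
    using within_proposal_measurable[OF m] by (simp add: split_beta)
  have q': "(\<lambda>w. within_proposal \<A> m (snd w) (fst w)) \<in> borel_measurable (?L \<Otimes>\<^sub>M ?L)"
    using measurable_compose[OF measurable_pair_swap' q] by (simp add: split_beta)
  note [measurable] = q q' measurable_compose[OF measurable_fst density_measurable[OF m]]
    measurable_compose[OF measurable_snd density_measurable[OF m]]
  have acc: "(\<lambda>w. within_accept \<A> m (fst w) (snd w)) \<in> borel_measurable (?L \<Otimes>\<^sub>M ?L)"
    unfolding within_accept_def Let_def by measurable
  have pr1: "(\<lambda>v. (m, snd (fst v))) \<in> (?L \<Otimes>\<^sub>M ?L) \<Otimes>\<^sub>M count_space (UNIV :: bool set) \<rightarrow>\<^sub>M state_space \<A>"
    by (rule measurable_compose[OF _ measurable_Pair_model[OF m]]) measurable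
  have pr2: "(\<lambda>v. (m, fst (fst v))) \<in> (?L \<Otimes>\<^sub>M ?L) \<Otimes>\<^sub>M count_space (UNIV :: bool set) \<rightarrow>\<^sub>M state_space \<A>"
    by (rule measurable_compose[OF _ measurable_Pair_model[OF m]]) measurable
  have inner: "(\<lambda>v. return (flagged_space \<A>)
      (if snd v then ((m, snd (fst v)), True) else ((m, fst (fst v)), False)))
      \<in> (?L \<Otimes>\<^sub>M ?L) \<Otimes>\<^sub>M count_space UNIV \<rightarrow>\<^sub>M prob_algebra (flagged_space \<A>)"
    by (rule measurable_compose[OF _ measurable_return_prob_space], rule measurable_If)
       (use pr1 pr2 in \<open>auto intro!: measurable_Pair\<close>)
  have outer: "(\<lambda>(x, y). measure_pmf (bernoulli_pmf (within_accept \<A> m x y)) \<bind> (\<lambda>b.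
         return (flagged_space \<A>) (if b then ((m, y), True) else ((m, x), False))))
     \<in> ?L \<Otimes>\<^sub>M ?L \<rightarrow>\<^sub>M prob_algebra (flagged_space \<A>)"
    using measurable_bind_prob_space2[OF measurable_compose[OF acc bernoulli_pmf_kernel],
        where R="flagged_space \<A>" and g="\<lambda>w b. return (flagged_space \<A>)
          (if b then ((m, snd w), True) else ((m, fst w), False))"]
      inner by (simp add: split_beta)
  show "(\<lambda>x. within_step \<A> (m, x)) \<in> region_lebesgue \<A> m \<rightarrow>\<^sub>M prob_algebra (flagged_space \<A>)"
    unfolding within_step_def prod.case
    by (rule measurable_bind_prob_space2[OF within_density_kernel[OF m] outer])
qed

lemma (in full_dim_trans_dim_mcmc) flagged_step_kernel:
  "flagged_step \<A> \<in> state_space \<A> \<rightarrow>\<^sub>M prob_algebra (flagged_space \<A>)"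
proof -
  have between: "(\<lambda>z. distr (between_step \<A> z) (flagged_space \<A>) (\<lambda>z'. (z', False)))
      \<in> state_space \<A> \<rightarrow>\<^sub>M prob_algebra (flagged_space \<A>)"
    by (rule measurable_distr_prob_space2[OF between_step_kernel]) measurable
  have branch: "(\<lambda>(z, b). if b then distr (between_step \<A> z) (flagged_space \<A>) (\<lambda>z'. (z', False))
        else within_step \<A> z)
      \<in> state_space \<A> \<Otimes>\<^sub>M count_space UNIV \<rightarrow>\<^sub>M prob_algebra (flagged_space \<A>)"
    unfolding split_beta
    by (rule measurable_If)
       (auto intro: measurable_compose[OF measurable_fst between]
          measurable_compose[OF measurable_fst within_step_kernel])
  have coin: "(\<lambda>z. measure_pmf (bernoulli_pmf (between_prob \<A>)))
      \<in> state_space \<A> \<rightarrow>\<^sub>M prob_algebra (count_space UNIV)"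
    by (rule measurable_const) (auto simp: space_prob_algebra intro: measure_pmf.prob_space_axioms)
  show ?thesis
    unfolding flagged_step_def[abs_def]
    by (rule measurable_bind_prob_space2[OF coin branch])
qed

lemma (in full_dim_trans_dim_mcmc) mcmc_kernel_kernel:
  "mcmc_kernel \<A> \<in> state_space \<A> \<rightarrow>\<^sub>M prob_algebra (state_space \<A>)"
  unfolding mcmc_kernel_def[abs_def]
  by (rule measurable_compose[OF flagged_step_kernel measurable_distr_prob_space[OF measurable_fst]])

lemma chain_Ionescu_Tulcea:
  assumes K: "K \<in> S \<rightarrow>\<^sub>M prob_algebra S" and z: "z \<in> space S"
  shows "Ionescu_Tulcea (\<lambda>n \<omega>. if n = 0 then return S z else K (\<omega> (n - 1))) (\<lambda>_. S)"
proof -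
  have K': "(\<lambda>\<omega>. if n = 0 then return S z else K (\<omega> (n - 1)))
      \<in> Pi\<^sub>M {0..<n} (\<lambda>_. S) \<rightarrow>\<^sub>M prob_algebra S" for n :: nat
  proof (cases "n = 0")
    case True
    have "return S z \<in> space (prob_algebra S)"
      using z by (simp add: space_prob_algebra prob_space_return)
    then show ?thesis using True by simp
  next
    case False
    then have "(\<lambda>\<omega>. \<omega> (n - 1)) \<in> Pi\<^sub>M {0..<n} (\<lambda>_. S) \<rightarrow>\<^sub>M S"
      by (intro measurable_component_singleton) simp
    from measurable_compose[OF this K] show ?thesis using False by simp
  qed
  show ?thesis
  proof (rule Ionescu_Tulcea.intro)
    show "(\<lambda>\<omega>. if n = 0 then return S z else K (\<omega> (n - 1)))
        \<in> Pi\<^sub>M {0..<n} (\<lambda>_. S) \<rightarrow>\<^sub>M subprob_algebra S" for n :: nat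
      by (rule measurable_prob_algebraD[OF K'])
    show "prob_space (if n = 0 then return S z else K (\<omega> (n - 1)))"
      if "\<omega> \<in> space (Pi\<^sub>M {0..<n} (\<lambda>_. S))" for n :: nat and \<omega>
      using measurable_space[OF K' that] by (simp only: space_prob_algebra mem_Collect_eq)
  qed
qed

end

theory Submission
  imports Defs
begin

text \<open>
  Let \<open>g z\<close> be the probability of ever hitting \<open>A\<close> from \<open>z\<close>, and \<open>u\<close> its modification with
  value 1 on \<open>A\<close>. Then \<open>K u = g \<le> u\<close>, and stationarity of \<open>\<pi>\<close> forces \<open>g = u\<close> almost everywhere.
  Hence \<open>{g = 1}\<close> and, again by stationarity, its complement are almost everywhere closed under the
  chain; \<open>\<phi>\<close>-irreducibility excludes that both have positive \<open>\<pi>\<close>-measure, so \<open>g = 1\<close> outside a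
  \<open>\<pi>\<close>-null set. An accepted within-model move has an absolutely continuous law and therefore avoids
  this null set. From an arbitrary starting point such a move happens almost surely, and
  the chain hits \<open>A\<close> afterwards.
\<close>

section \<open>Hitting probabilities of a Markov kernel\<close>

primrec hit_within :: "('a \<Rightarrow> 'a measure) \<Rightarrow> 'a set \<Rightarrow> nat \<Rightarrow> 'a \<Rightarrow> ennreal" where
  "hit_within K A 0 z = 0"
| "hit_within K A (Suc n) z = (\<integral>\<^sup>+y. (if y \<in> A then 1 else hit_within K A n y) \<partial>K z)"

text \<open>The recursion inspects only the states after the first step, so the starting point
  itself never counts, in accordance with \<open>n \<ge> 1\<close> in \<open>hitting_time\<close>.
  First-step analysis is thus built into the definition, and the link with the trajectory measure is
  made once, in \<open>chain_law_hitting_time\<close>.\<close>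

definition hit_prob :: "('a \<Rightarrow> 'a measure) \<Rightarrow> 'a set \<Rightarrow> 'a \<Rightarrow> ennreal" where
  "hit_prob K A z = (SUP n. hit_within K A n z)"

lemma hitting_time_finite_iff: "hitting_time A \<omega> < \<infinity> \<longleftrightarrow> (\<exists>n\<ge>1. \<omega> n \<in> A)"
  unfolding hitting_time_def INF_less_iff by auto

text \<open>A general kernel, because the results are applied to two chains:
  \<open>mcmc_kernel\<close> on the states and \<open>flagged_step\<close> on the states with
  flags.\<close>

locale markov_kernel =
  fixes S :: "'a measure" and K :: "'a \<Rightarrow> 'a measure"
  assumes kernel: "K \<in> S \<rightarrow>\<^sub>M prob_algebra S"
begin

lemma subprob_kernel [measurable]: "K \<in> S \<rightarrow>\<^sub>M subprob_algebra S"
  by (rule measurable_prob_algebraD[OF kernel])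

lemma prob_space_kernel: "z \<in> space S \<Longrightarrow> prob_space (K z)"
  using measurable_space[OF kernel] by (simp add: space_prob_algebra)

lemma sets_kernel: "z \<in> space S \<Longrightarrow> sets (K z) = sets S"
  by (rule subprob_measurableD(2)[OF subprob_kernel])

lemma space_kernel: "z \<in> space S \<Longrightarrow> space (K z) = space S"
  by (rule subprob_measurableD(1)[OF subprob_kernel])

lemma emeasure_kernel_space: "z \<in> space S \<Longrightarrow> emeasure (K z) (space S) = 1"
  using prob_space.emeasure_space_1[OF prob_space_kernel] space_kernel by metis

lemma borel_measurable_kernel:
  "z \<in> space S \<Longrightarrow> f \<in> borel_measurable S \<Longrightarrow> f \<in> borel_measurable (K z)"
  by (simp add: measurable_cong_sets[OF sets_kernel refl])

lemma measurable_hit_within [measurable]: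
  assumes [measurable]: "A \<in> sets S"
  shows "hit_within K A n \<in> borel_measurable S"
proof (induction n)
  case (Suc n)
  note Suc [measurable]
  have "(\<lambda>y. if y \<in> A then 1 else hit_within K A n y) \<in> borel_measurable S"
    by measurable
  from measurable_compose[OF subprob_kernel nn_integral_measurable_subprob_algebra[OF this]]
  show ?case by simp
qed simp

lemma measurable_hit_prob [measurable]:
  assumes [measurable]: "A \<in> sets S"
  shows "hit_prob K A \<in> borel_measurable S"
  unfolding hit_prob_def by measurable

lemma hit_within_le_1: "z \<in> space S \<Longrightarrow> hit_within K A n z \<le> 1"
proof (induction n arbitrary: z)
  case (Suc n)
  have "hit_within K A (Suc n) z \<le> (\<integral>\<^sup>+y. 1 \<partial>K z)"
    unfolding hit_within.simps
    by (rule nn_integral_mono) (use Suc in \<open>auto simp: space_kernel\<close>)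
  then show ?case
    using Suc.prems by (simp add: space_kernel emeasure_kernel_space)
qed simp

lemma hit_prob_le_1: "z \<in> space S \<Longrightarrow> hit_prob K A z \<le> 1"
  unfolding hit_prob_def by (rule SUP_least) (rule hit_within_le_1)

lemma hit_within_Suc: "hit_within K A n z \<le> hit_within K A (Suc n) z"
proof (induction n arbitrary: z)
  case (Suc n)
  show ?case
    unfolding hit_within.simps(2)[of K A n] hit_within.simps(2)[of K A "Suc n"]
    by (rule nn_integral_mono) (use Suc in auto)
qed simp

lemma incseq_hit_within: "incseq (\<lambda>n. hit_within K A n z)"
  by (rule incseq_SucI) (rule hit_within_Suc)

text \<open>Monotone convergence carries the recursion of \<open>hit_within\<close> over to the
  limit.\<close>

lemma hit_prob_step:
  assumes A [measurable]: "A \<in> sets S" and z: "z \<in> space S"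
  shows "hit_prob K A z = (\<integral>\<^sup>+y. (if y \<in> A then 1 else hit_prob K A y) \<partial>K z)"
proof -
  let ?f = "\<lambda>n y. if y \<in> A then 1 else hit_within K A n y"
  have "hit_prob K A z = (SUP n. hit_within K A (Suc n) z)"
    unfolding hit_prob_def
    by (intro antisym SUP_mono) (use hit_within_Suc in blast)+
  also have "\<dots> = (SUP n. \<integral>\<^sup>+y. ?f n y \<partial>K z)" by simp
  also have "\<dots> = (\<integral>\<^sup>+y. (SUP n. ?f n y) \<partial>K z)"
  proof (rule nn_integral_monotone_convergence_SUP[symmetric])
    show "incseq ?f"
      using incseq_hit_within[of A] by (auto simp: incseq_def le_fun_def)
    show "?f n \<in> borel_measurable (K z)" for n
      by (rule borel_measurable_kernel[OF z]) measurable
  qed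
  also have "\<dots> = (\<integral>\<^sup>+y. (if y \<in> A then 1 else hit_prob K A y) \<partial>K z)"
    by (rule nn_integral_cong) (auto simp: hit_prob_def)
  finally show ?thesis .
qed

text \<open>The conditional probability of a hit by time \<open>N\<close>, given the path up to time
  \<open>n\<close>, is a martingale in \<open>n\<close>. It starts at
  \<open>hit_within K A N z\<close> for \<open>n = 0\<close> and ends as the indicator of a hit for
  \<open>n = N\<close>; continuity from below then lets \<open>N\<close> grow.\<close>

lemma chain_law_hitting_time:
  assumes A [measurable]: "A \<in> sets S" and z: "z \<in> space S"
  shows "prob_space (chain_law S K z)"
    and "space (chain_law S K z) = space (Pi\<^sub>M UNIV (\<lambda>_. S))"
    and "{\<omega> \<in> space (chain_law S K z). hitting_time A \<omega> < \<infinity>} \<in> sets (chain_law S K z)"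
    and "emeasure (chain_law S K z) {\<omega> \<in> space (chain_law S K z). hitting_time A \<omega> < \<infinity>}
       = hit_prob K A z"
proof -
  let ?P = "\<lambda>n \<omega>. if n = 0 then return S z else K (\<omega> (n - 1))"
  interpret IT: Ionescu_Tulcea ?P "\<lambda>_. S"
    by (rule chain_Ionescu_Tulcea[OF kernel z])
  let ?Pi = "\<lambda>n. Pi\<^sub>M {0..<n} (\<lambda>_. S)"
  \<comment> \<open>The only point of the empty product, from which the composed kernels
    \<open>IT.C 0 n\<close> start.\<close>
  let ?u = "\<lambda>_::nat. undefined :: 'a"
  have u: "?u \<in> space (?Pi 0)" by (simp add: space_PiM)
  have law: "chain_law S K z = IT.PF.lim" by (simp add: chain_law_def)
  show space: "space (chain_law S K z) = space (Pi\<^sub>M UNIV (\<lambda>_. S))"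
    by (simp add: law)
  \<comment> \<open>\<open>IT.CI J\<close> is the composed kernel projected to the coordinates in
    \<open>J\<close>; for an initial segment nothing is projected away.\<close>
  have CI: "IT.CI {0..<n} = IT.C 0 n ?u" for n
  proof (rule measure_eqI)
    show "sets (IT.CI {0..<n}) = sets (IT.C 0 n ?u)"
      using IT.sets_C[OF u, of n] by (simp add: IT.CI_def)
    fix X assume "X \<in> sets (IT.CI {0..<n})"
    then have X: "X \<in> sets (?Pi n)" by (simp add: IT.CI_def)
    then show "emeasure (IT.CI {0..<n}) X = emeasure (IT.C 0 n ?u) X"
      using IT.emeasure_CI[OF subset_refl X] sets.sets_into_space[OF X]
      by (simp add: prod_emb_id space_PiM)
  qed
  show "prob_space (chain_law S K z)"
  proof (rule prob_spaceI)
    \<comment> \<open>The cylinder over the empty index set is the whole trajectory space, so its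
      measure is the total mass.\<close>
    have "emeasure IT.PF.lim (IT.PF.emb UNIV {} (space (Pi\<^sub>M {} (\<lambda>_. S)))) =
        emeasure (IT.CI {}) (space (Pi\<^sub>M {} (\<lambda>_. S)))"
      by (rule IT.lim) auto
    also have "\<dots> = 1"
      using prob_space.emeasure_space_1[OF IT.PF.prob_space_P[of "{}"]] IT.PF.space_P[of "{}"] by simp
    also have "IT.PF.emb UNIV {} (space (Pi\<^sub>M {} (\<lambda>_. S))) = space IT.PF.lim"
      by (auto simp: prod_emb_def space_PiM)
    finally show "emeasure (chain_law S K z) (space (chain_law S K z)) = 1" by (simp add: law)
  qed
  define hit where "hit n = {\<omega>. \<exists>i\<in>{1..n}. \<omega> i \<in> A}" for n :: nat
  \<comment> \<open>The martingale: 1 once a hit in \<open>{1..n}\<close> has occurred, otherwise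
    the chance of a hit from \<open>\<omega> n\<close> in the remaining \<open>N - n\<close>
    steps.\<close>
  let ?\<Phi> = "\<lambda>N n \<omega>. if \<omega> \<in> hit n then 1 else hit_within K A (N - n) (\<omega> n)"
  have pred_hit [measurable]: "Measurable.pred (?Pi (Suc n)) (\<lambda>\<omega>. \<omega> \<in> hit n)" for n
  proof -
    have "(\<lambda>\<omega>. \<omega> i) \<in> ?Pi (Suc n) \<rightarrow>\<^sub>M S" if "i \<in> {1..n}" for i
      by (rule measurable_component_singleton) (use that in auto)
    then show ?thesis unfolding hit_def mem_Collect_eq
      by (intro pred_intros_finite) (auto intro: measurable_compose)
  qed
  have comp [measurable]: "(\<lambda>\<omega>. \<omega> n) \<in> ?Pi (Suc n) \<rightarrow>\<^sub>M S" for n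
    by (rule measurable_component_singleton) auto
  have \<Phi>_meas: "?\<Phi> N n \<in> borel_measurable (?Pi (Suc n))" for N n
    by measurable
  \<comment> \<open>\<open>IT.C 0 (Suc n)\<close> is the law of the coordinates 0 to
    \<open>n\<close>, so \<open>\<omega> n\<close> is the most recent state. The expectation does
    not change from \<open>n\<close> to \<open>Suc n\<close>, and at \<open>n = 0\<close> the path
    is the point \<open>z\<close>.\<close>
  have \<Phi>: "(\<integral>\<^sup>+\<omega>. ?\<Phi> N n \<omega> \<partial>IT.C 0 (Suc n) ?u) = hit_within K A N z" if "n \<le> N" for N n
    using that
  proof (induction n)
    case 0
    have "(\<integral>\<^sup>+\<omega>. ?\<Phi> N 0 \<omega> \<partial>IT.C 0 (Suc 0) ?u) = (\<integral>\<^sup>+\<omega>. ?\<Phi> N 0 \<omega> \<partial>IT.eP 0 ?u)"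
      using bind_return[OF IT.measurable_eP u] by simp
    also have "\<dots> = (\<integral>\<^sup>+x. ?\<Phi> N 0 (?u(0 := x)) \<partial>return S z)"
      using IT.nn_integral_eP[OF u \<Phi>_meas] by simp
    also have "\<dots> = hit_within K A N z"
      using z by (simp add: hit_def nn_integral_return)
    finally show ?case .
  next
    case (Suc n)
    have "(\<integral>\<^sup>+\<omega>. ?\<Phi> N (Suc n) \<omega> \<partial>IT.C 0 (Suc (Suc n)) ?u) =
        (\<integral>\<^sup>+\<omega>. (\<integral>\<^sup>+\<omega>'. ?\<Phi> N (Suc n) \<omega>' \<partial>IT.eP (Suc n) \<omega>) \<partial>IT.C 0 (Suc n) ?u)"
      unfolding IT.C.simps(2)[of 0 "Suc n"] add_0
      by (rule nn_integral_bind[OF \<Phi>_meas])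
         (simp add: measurable_cong_sets[OF IT.sets_C[OF u] refl] IT.measurable_eP del: IT.C.simps)
    also have "\<dots> = (\<integral>\<^sup>+\<omega>. ?\<Phi> N n \<omega> \<partial>IT.C 0 (Suc n) ?u)"
    proof (rule nn_integral_cong)
      fix \<omega> assume "\<omega> \<in> space (IT.C 0 (Suc n) ?u)"
      then have \<omega>: "\<omega> \<in> space (?Pi (Suc n))" by (simp only: IT.space_C[OF u] add_0)
      then have \<omega>n: "\<omega> n \<in> space S" by (auto simp: space_PiM)
      have upd: "fun_upd \<omega> (Suc n) x \<in> hit (Suc n) \<longleftrightarrow> x \<in> A \<or> \<omega> \<in> hit n" for x
        by (auto simp: hit_def atLeastAtMostSuc_conv)
      have "(\<integral>\<^sup>+\<omega>'. ?\<Phi> N (Suc n) \<omega>' \<partial>IT.eP (Suc n) \<omega>) =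
          (\<integral>\<^sup>+x. ?\<Phi> N (Suc n) (fun_upd \<omega> (Suc n) x) \<partial>K (\<omega> n))"
        using IT.nn_integral_eP[OF \<omega> \<Phi>_meas] by simp
      also have "\<dots> = ?\<Phi> N n \<omega>"
      proof (cases "\<omega> \<in> hit n")
        case True
        then show ?thesis
          by (simp add: upd space_kernel[OF \<omega>n] emeasure_kernel_space[OF \<omega>n])
      next
        case False
        \<comment> \<open>Here \<open>Suc n \<le> N\<close> matters: at least one step remains, so
          \<open>hit_within\<close> unfolds exactly once.\<close>
        have "N - n = Suc (N - Suc n)" using Suc.prems by simp
        with False show ?thesis by (simp add: upd cong: if_cong)
      qed
      finally show "(\<integral>\<^sup>+\<omega>'. ?\<Phi> N (Suc n) \<omega>' \<partial>IT.eP (Suc n) \<omega>) = ?\<Phi> N n \<omega>" .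
    qed
    also have "\<dots> = hit_within K A N z" using Suc by simp
    finally show ?case .
  qed
  have comp_lim [measurable]: "(\<lambda>\<omega>. \<omega> i) \<in> IT.PF.lim \<rightarrow>\<^sub>M S" for i
    using measurable_component_singleton[of i UNIV "\<lambda>_. S"]
    by (simp add: measurable_cong_sets[OF IT.PF.sets_lim refl])
  have hit_lim: "emeasure IT.PF.lim (hit N \<inter> space IT.PF.lim) = hit_within K A N z" for N
  proof -
    let ?H = "hit N \<inter> space (?Pi (Suc N))"
    have H: "?H \<in> sets (?Pi (Suc N))"
      using pred_hit[of N] by (simp add: pred_def Int_def conj_commute)
    \<comment> \<open>A hit by time \<open>N\<close> is a cylinder event over the coordinates 0 to
      \<open>N\<close>, so the limit measure gives it the mass it has under the composed
      kernel.\<close>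
    have "hit N \<inter> space IT.PF.lim = IT.PF.emb UNIV {0..<Suc N} ?H"
      by (auto simp: prod_emb_def space_PiM hit_def PiE_iff)
    then have "emeasure IT.PF.lim (hit N \<inter> space IT.PF.lim) = emeasure (IT.C 0 (Suc N) ?u) ?H"
      using IT.lim[OF _ H] CI[of "Suc N"] by simp
    also have "\<dots> = (\<integral>\<^sup>+\<omega>. indicator ?H \<omega> \<partial>IT.C 0 (Suc N) ?u)"
      using H IT.sets_C[OF u, of "Suc N"] by (subst nn_integral_indicator) auto
    \<comment> \<open>No steps remain at \<open>n = N\<close>, and \<open>hit_within K A 0\<close>
      is 0, so the martingale is an indicator.\<close>
    also have "\<dots> = (\<integral>\<^sup>+\<omega>. ?\<Phi> N N \<omega> \<partial>IT.C 0 (Suc N) ?u)"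
    proof (rule nn_integral_cong)
      fix \<omega> assume "\<omega> \<in> space (IT.C 0 (Suc N) ?u)"
      then have "\<omega> \<in> space (?Pi (Suc N))" by (simp only: IT.space_C[OF u] add_0)
      then show "indicator ?H \<omega> = ?\<Phi> N N \<omega>" by simp
    qed
    also have "\<dots> = hit_within K A N z" by (rule \<Phi>) simp
    finally show ?thesis .
  qed
  have sets_hit: "hit N \<inter> space IT.PF.lim \<in> sets IT.PF.lim" for N
  proof -
    have "hit N \<inter> space IT.PF.lim = {\<omega> \<in> space IT.PF.lim. \<exists>i\<in>{1..N}. \<omega> i \<in> A}"
      by (auto simp: hit_def)
    also have "\<dots> \<in> sets IT.PF.lim" by measurable
    finally show ?thesis .
  qed
  have union: "{\<omega> \<in> space (chain_law S K z). hitting_time A \<omega> < \<infinity>} = (\<Union>N. hit N \<inter> space IT.PF.lim)"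
    unfolding law hitting_time_finite_iff by (auto simp: hit_def) (metis atLeastAtMost_iff order_refl)
  show "{\<omega> \<in> space (chain_law S K z). hitting_time A \<omega> < \<infinity>} \<in> sets (chain_law S K z)"
    unfolding union unfolding law using sets_hit by (intro sets.countable_UN) auto
  have "(SUP N. emeasure IT.PF.lim (hit N \<inter> space IT.PF.lim)) =
      emeasure IT.PF.lim (\<Union>N. hit N \<inter> space IT.PF.lim)"
    by (rule SUP_emeasure_incseq) (use sets_hit in \<open>force simp: incseq_def hit_def\<close>)+
  then show "emeasure (chain_law S K z) {\<omega> \<in> space (chain_law S K z). hitting_time A \<omega> < \<infinity>}
       = hit_prob K A z"
    unfolding union unfolding law by (simp only: hit_lim hit_prob_def)
qed

end

section \<open>Stationary kernels: hitting with probability one from almost every start\<close>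

locale stationary_markov_kernel = markov_kernel +
  fixes \<pi> :: "'a measure"
  assumes stationary: "stationary S K \<pi>"
begin

sublocale prob_space \<pi>
  using stationary by (simp add: stationary_def)

lemma sets_\<pi>: "sets \<pi> = sets S"
  using stationary by (simp add: stationary_def)

lemma space_\<pi>: "space \<pi> = space S"
  by (rule sets_eq_imp_space_eq[OF sets_\<pi>])

lemma measurable_\<pi> [simp]: "f \<in> \<pi> \<rightarrow>\<^sub>M N \<longleftrightarrow> f \<in> S \<rightarrow>\<^sub>M N"
  by (simp add: measurable_cong_sets[OF sets_\<pi> refl])

lemma emeasure_stationary: "E \<in> sets S \<Longrightarrow> (\<integral>\<^sup>+z. emeasure (K z) E \<partial>\<pi>) = emeasure \<pi> E"
  using stationary by (simp add: stationary_def)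

text \<open>Invariance in monadic form makes \<open>nn_integral_bind\<close> and
  \<open>AE_bind\<close> available: the first extends it from sets to functions, the second pulls
  null sets back by one step.\<close>

lemma bind_stationary: "\<pi> \<bind> K = \<pi>"
proof (rule measure_eqI)
  show sets: "sets (\<pi> \<bind> K) = sets \<pi>"
    by (subst sets_bind[where N=S]) (auto simp: sets_\<pi> space_\<pi> sets_kernel not_empty[unfolded space_\<pi>])
  fix E assume "E \<in> sets (\<pi> \<bind> K)"
  then have E: "E \<in> sets S" using sets sets_\<pi> by simp
  have "emeasure (\<pi> \<bind> K) E = (\<integral>\<^sup>+z. emeasure (K z) E \<partial>\<pi>)"
    by (rule emeasure_bind[OF not_empty _ E]) simp
  then show "emeasure (\<pi> \<bind> K) E = emeasure \<pi> E"
    by (simp add: emeasure_stationary[OF E])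
qed

lemma nn_integral_stationary:
  assumes "f \<in> borel_measurable S"
  shows "(\<integral>\<^sup>+z. (\<integral>\<^sup>+y. f y \<partial>K z) \<partial>\<pi>) = (\<integral>\<^sup>+z. f z \<partial>\<pi>)"
  using nn_integral_bind[OF assms, of K \<pi>] by (simp add: bind_stationary)

lemma AE_stationary:
  assumes "Measurable.pred S P" "AE z in \<pi>. P z"
  shows "AE z in \<pi>. AE y in K z. P y"
  using AE_bind[OF _ assms(1), of K \<pi>] assms(2) unfolding bind_stationary by simp

text \<open>Induction on the horizon. Since \<open>C\<close> is closed only up to a null set, a step
  may land in the exceptional set of the previous horizon; by \<open>AE_stationary\<close> this has
  positive probability from a null set of points only.\<close>

lemma AE_closed_hit_prob_eq_0:
  assumes C [measurable]: "C \<in> sets S"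
    and closed: "AE z in \<pi>. z \<in> C \<longrightarrow> (AE y in K z. y \<in> C)"
  shows "AE z in \<pi>. z \<in> C \<longrightarrow> hit_prob K (space S - C) z = 0"
proof -
  let ?g = "\<lambda>n. hit_within K (space S - C) n"
  have "AE z in \<pi>. z \<in> C \<longrightarrow> ?g n z = 0" for n
  proof (induction n)
    case (Suc n)
    have "AE z in \<pi>. AE y in K z. y \<in> C \<longrightarrow> ?g n y = 0"
      by (rule AE_stationary[OF _ Suc]) measurable
    with closed AE_space show ?case
    proof eventually_elim
      case (elim z)
      show ?case
      proof
        assume "z \<in> C"
        with elim have "AE y in K z. y \<in> C" by simp
        moreover have "AE y in K z. y \<in> C \<longrightarrow> ?g n y = 0" by (rule elim)
        ultimately have "AE y in K z. (if y \<in> space S - C then 1 else ?g n y) = 0"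
          by eventually_elim auto
        then have "(\<integral>\<^sup>+y. (if y \<in> space S - C then 1 else ?g n y) \<partial>K z) = (\<integral>\<^sup>+y. 0 \<partial>K z)"
          by (rule nn_integral_cong_AE)
        then show "?g (Suc n) z = 0" by simp
      qed
    qed
  qed simp
  \<comment> \<open>Countably many horizons share one null set.\<close>
  then have "AE z in \<pi>. \<forall>n. z \<in> C \<longrightarrow> ?g n z = 0"
    unfolding AE_all_countable by blast
  then show ?thesis
    by eventually_elim (simp add: hit_prob_def)
qed

text \<open>Irreducibility and invariance yield recurrence only off a null set of starts. For the
  sampler, accepted within-model moves will get the chain out of that set.\<close>

lemma AE_hit_prob_eq_1:
  assumes irr: "phi_irreducible S K"
    and A [measurable]: "A \<in> sets S" and A_pos: "emeasure \<pi> A > 0"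
  shows "AE z in \<pi>. hit_prob K A z = 1"
proof -
  obtain \<psi> where \<psi>: "sets \<psi> = sets S" "emeasure \<psi> (space S) \<noteq> 0"
    and irr': "\<And>z E. z \<in> space S \<Longrightarrow> E \<in> sets S \<Longrightarrow> emeasure \<psi> E > 0 \<Longrightarrow>
       \<P>(\<omega> in chain_law S K z. hitting_time E \<omega> < \<infinity>) > 0"
    using irr by (auto simp: phi_irreducible_def)
  have hit_pos: "hit_prob K E z > 0" if "z \<in> space S" "E \<in> sets S" "emeasure \<psi> E > 0" for z E
    using irr'[OF that] chain_law_hitting_time(4)[OF that(2,1)]
    by (metis measure_def enn2real_0 not_gr_zero less_irrefl)
  let ?g = "hit_prob K A"
  let ?u = "\<lambda>y. if y \<in> A then 1 else ?g y"
  define B where "B = {z \<in> space S. ?g z = 1}"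
  have u [measurable]: "?u \<in> borel_measurable S" by measurable
  have B [measurable]: "B \<in> sets S" unfolding B_def by measurable
  have g_le_u: "?g z \<le> ?u z" if "z \<in> space S" for z
    using hit_prob_le_1[OF that] by simp
  \<comment> \<open>Since \<open>?g\<close> is the one-step average of \<open>?u\<close>, invariance
    gives both the same integral. This integral is finite and \<open>?g \<le> ?u\<close>, so the two
    agree almost everywhere.\<close>
  have "(\<integral>\<^sup>+z. ?g z \<partial>\<pi>) = (\<integral>\<^sup>+z. (\<integral>\<^sup>+y. ?u y \<partial>K z) \<partial>\<pi>)"
    by (rule nn_integral_cong) (simp add: hit_prob_step space_\<pi>)
  then have int_eq: "(\<integral>\<^sup>+z. ?g z \<partial>\<pi>) = (\<integral>\<^sup>+z. ?u z \<partial>\<pi>)"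
    by (simp only: nn_integral_stationary[OF u])
  have "(\<integral>\<^sup>+z. ?g z \<partial>\<pi>) \<le> (\<integral>\<^sup>+z. 1 \<partial>\<pi>)"
    by (rule nn_integral_mono) (simp add: hit_prob_le_1 space_\<pi>)
  then have fin: "(\<integral>\<^sup>+z. ?g z \<partial>\<pi>) \<noteq> \<infinity>"
    by (auto simp: emeasure_space_1 top_unique)
  have "(\<integral>\<^sup>+z. ?u z - ?g z \<partial>\<pi>) = 0"
    by (subst nn_integral_diff) (use fin int_eq in \<open>auto simp: space_\<pi> intro!: AE_I2 hit_prob_le_1\<close>)
  then have "AE z in \<pi>. ?u z - ?g z = 0"
    by (subst (asm) nn_integral_0_iff_AE) auto
  with AE_space have AE_eq: "AE z in \<pi>. ?u z = ?g z"
    by eventually_elim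
       (metis g_le_u space_\<pi> diff_eq_0_iff_ennreal antisym hit_prob_le_1)
  \<comment> \<open>Poincare recurrence: \<open>?u\<close> is 1 on \<open>A\<close>, so almost every
    point of \<open>A\<close> returns to \<open>A\<close> with probability one.\<close>
  then have "AE z in \<pi>. z \<in> A \<longrightarrow> z \<in> B"
    using AE_space by eventually_elim (auto simp: B_def space_\<pi> split: if_splits)
  then have "emeasure \<pi> A \<le> emeasure \<pi> B"
    by (rule emeasure_mono_AE) (simp add: sets_\<pi>)
  with A_pos have B_pos: "emeasure \<pi> B > 0" by simp
  \<comment> \<open>At a point of \<open>B\<close> the function \<open>?u\<close>, bounded by 1, has
    average 1 under \<open>K z\<close>, hence is 1 almost surely after one step. Pulling back the
    almost sure equality of \<open>?u\<close> and \<open>?g\<close> turns this into membership in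
    \<open>B\<close>.\<close>
  have B_closed: "AE z in \<pi>. z \<in> B \<longrightarrow> (AE y in K z. y \<in> B)"
  proof -
    have "AE z in \<pi>. AE y in K z. ?u y = ?g y"
      by (rule AE_stationary[OF _ AE_eq]) measurable
    with AE_space show ?thesis
    proof eventually_elim
      case (elim z)
      then have z: "z \<in> space S" by (simp add: space_\<pi>)
      interpret Kz: prob_space "K z" by (rule prob_space_kernel[OF z])
      have le: "?u y \<le> 1" if "y \<in> space (K z)" for y
        using that hit_prob_le_1 z by (simp add: space_kernel)
      show ?case
      proof
        assume "z \<in> B"
        then have "(\<integral>\<^sup>+y. ?u y \<partial>K z) = 1"
          using z hit_prob_step[OF A z] by (simp add: B_def)
        then have "(\<integral>\<^sup>+y. 1 - ?u y \<partial>K z) = 0"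
          by (subst nn_integral_diff)
             (use le z in \<open>auto simp: borel_measurable_kernel Kz.emeasure_space_1\<close>)
        then have "AE y in K z. 1 - ?u y = 0"
          by (subst (asm) nn_integral_0_iff_AE) (auto simp: borel_measurable_kernel z)
        with elim(2) AE_space show "AE y in K z. y \<in> B"
        proof eventually_elim
          case (elim y)
          then have "?g y = 1"
            using le[of y] by (metis antisym diff_eq_0_iff_ennreal ennreal_one_less_top less_irrefl)
          then show ?case using elim z by (simp add: B_def space_kernel)
        qed
      qed
    qed
  qed
  \<comment> \<open>Mass balance: almost no mass leaves \<open>B\<close> in one step, so by
    invariance, and because \<open>\<pi>\<close> is finite, the mass flowing into \<open>B\<close>
    from outside is 0.\<close>
  have C_closed: "AE z in \<pi>. z \<in> space S - B \<longrightarrow> (AE y in K z. y \<in> space S - B)"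
  proof -
    have KB [measurable]: "(\<lambda>z. emeasure (K z) B) \<in> borel_measurable S"
      by (rule measurable_emeasure_kernel[OF subprob_kernel B])
    have "emeasure \<pi> B + (\<integral>\<^sup>+z. emeasure (K z) B * indicator (space S - B) z \<partial>\<pi>) =
      (\<integral>\<^sup>+z. emeasure (K z) B * indicator B z \<partial>\<pi>) +
      (\<integral>\<^sup>+z. emeasure (K z) B * indicator (space S - B) z \<partial>\<pi>)"
    proof -
      have "emeasure \<pi> B = (\<integral>\<^sup>+z. indicator B z \<partial>\<pi>)" by (simp add: sets_\<pi>)
      also have "\<dots> = (\<integral>\<^sup>+z. emeasure (K z) B * indicator B z \<partial>\<pi>)"
      proof (rule nn_integral_cong_AE)
        show "AE z in \<pi>. indicator B z = emeasure (K z) B * indicator B z"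
          using B_closed AE_space
        proof eventually_elim
          case (elim z)
          then have z: "z \<in> space S" by (simp add: space_\<pi>)
          then interpret Kz: prob_space "K z" by (rule prob_space_kernel)
          show ?case
            using elim Kz.emeasure_eq_1_AE[of B] sets_kernel[OF z] B by (auto split: split_indicator)
        qed
      qed
      finally show ?thesis by simp
    qed
    also have "\<dots> = (\<integral>\<^sup>+z. emeasure (K z) B * indicator B z +
        emeasure (K z) B * indicator (space S - B) z \<partial>\<pi>)"
      by (rule nn_integral_add[symmetric]) auto
    also have "\<dots> = (\<integral>\<^sup>+z. emeasure (K z) B \<partial>\<pi>)"
      by (rule nn_integral_cong) (auto simp: space_\<pi> split: split_indicator)
    also have "\<dots> = emeasure \<pi> B" by (rule emeasure_stationary[OF B])
    finally have "(\<integral>\<^sup>+z. emeasure (K z) B * indicator (space S - B) z \<partial>\<pi>) = 0"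
      using emeasure_finite[of B] by (metis add.right_neutral ennreal_add_left_cancel infinity_ennreal_def)
    then have "AE z in \<pi>. emeasure (K z) B * indicator (space S - B) z = 0"
      by (subst (asm) nn_integral_0_iff_AE) auto
    with AE_space show ?thesis
    proof eventually_elim
      case (elim z)
      then have z: "z \<in> space S" by (simp add: space_\<pi>)
      show ?case
      proof
        assume "z \<in> space S - B"
        then have "emeasure (K z) B = 0" using elim by simp
        then have "AE y in K z. y \<notin> B"
          using z by (intro AE_not_in) (auto simp: null_sets_def sets_kernel)
        then show "AE y in K z. y \<in> space S - B"
          using AE_space by eventually_elim (simp add: z space_kernel)
      qed
    qed
  qed
  \<comment> \<open>Almost every point of an almost closed \<open>C\<close> has probability 0 of
    ever leaving it. If \<open>C\<close> has positive mass such a point exists, and irreducibility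
    makes the complement \<open>\<psi>\<close>-null. Were both \<open>B\<close> and its complement
    of positive mass, \<open>\<psi>\<close> would vanish altogether.\<close>
  have null: "emeasure \<psi> (space S - C) = 0"
    if C: "C \<in> sets S" "emeasure \<pi> C > 0" "AE z in \<pi>. z \<in> C \<longrightarrow> (AE y in K z. y \<in> C)" for C
  proof (rule ccontr)
    assume "emeasure \<psi> (space S - C) \<noteq> 0"
    then have pos: "hit_prob K (space S - C) z > 0" if "z \<in> space S" for z
      using that C by (intro hit_pos) (auto simp: zero_less_iff_neq_zero)
    have "AE z in \<pi>. z \<notin> C"
      using AE_closed_hit_prob_eq_0[OF C(1,3)] AE_space
      by eventually_elim (use pos in \<open>force simp: space_\<pi>\<close>)
    then have "emeasure \<pi> C = 0"
      using C(1) by (subst (asm) AE_iff_null_sets[symmetric]) (auto simp: sets_\<pi>)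
    with C(2) show False by simp
  qed
  have "emeasure \<pi> (space S - B) = 0"
  proof (rule ccontr)
    assume "emeasure \<pi> (space S - B) \<noteq> 0"
    then have "emeasure \<psi> (space S - (space S - B)) = 0"
      by (intro null[OF _ _ C_closed]) (auto simp: zero_less_iff_neq_zero)
    moreover have "space S - (space S - B) = B"
      using sets.sets_into_space[OF B] by auto
    moreover have "emeasure \<psi> (space S) = emeasure \<psi> B + emeasure \<psi> (space S - B)"
      using sets.sets_into_space[OF B] by (subst plus_emeasure) (auto simp: \<psi>(1) Un_absorb1)
    ultimately show False using \<psi>(2) null[OF B B_pos B_closed] by simp
  qed
  then have "AE z in \<pi>. z \<notin> space S - B"
    by (intro AE_not_in) (auto simp: null_sets_def sets_\<pi>)
  with AE_space show ?thesis
    by eventually_elim (auto simp: B_def space_\<pi>)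
qed

end

section \<open>One step of the sampler and invariance of the target\<close>

lemma emeasure_bernoulli_bind_return:
  assumes p: "0 \<le> p" "p \<le> 1" and h: "\<And>b. h b \<in> space N" and E: "E \<in> sets N"
  shows "emeasure (measure_pmf (bernoulli_pmf p) \<bind> (\<lambda>b. return N (h b))) E =
    ennreal p * indicator E (h True) + ennreal (1 - p) * indicator E (h False)"
proof -
  have "emeasure (measure_pmf (bernoulli_pmf p) \<bind> (\<lambda>b. return N (h b))) E =
      (\<integral>\<^sup>+b. emeasure (return N (h b)) E \<partial>measure_pmf (bernoulli_pmf p))"
  proof (rule emeasure_bind_prob_algebra[OF _ _ E])
    show "measure_pmf (bernoulli_pmf p) \<in> space (prob_algebra (count_space UNIV))"
      by (simp add: space_prob_algebra measure_pmf.prob_space_axioms)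
    show "(\<lambda>b. return N (h b)) \<in> count_space UNIV \<rightarrow>\<^sub>M prob_algebra N"
      by (rule measurable_compose[OF _ measurable_return_prob_space]) (simp add: h)
  qed
  then show ?thesis
    by (simp add: p emeasure_return[OF E] mult.commute)
qed

context full_dim_trans_dim_mcmc
begin

lemma sets_slice:
  assumes "m \<in> models \<A>" "E \<in> sets (state_space \<A>)"
  shows "Pair m -` E \<inter> space (region_lebesgue \<A> m) \<in> sets (region_lebesgue \<A> m)"
  using measurable_sets[OF measurable_Pair_model] assms by blast

lemma sets_target: "sets (target \<A>) = sets (state_space \<A>)"
  unfolding target_def by simp

lemma space_target: "space (target \<A>) = space (state_space \<A>)"
  by (rule sets_eq_imp_space_eq[OF sets_target])

text \<open>\<open>target\<close> is specified by its values on sets, so integrals are reached by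
  induction over measurable functions; the right-hand side is linear and continuous along increasing
  sequences in \<open>h\<close>.\<close>

lemma nn_integral_target:
  assumes "h \<in> borel_measurable (state_space \<A>)"
  shows "(\<integral>\<^sup>+z. h z \<partial>target \<A>) = (\<integral>\<^sup>+m. ennreal (model_weight \<A> m) *
      (\<integral>\<^sup>+x. ennreal (unnorm_density \<A> m x) * h (m, x) \<partial>region_lebesgue \<A> m) /
      (\<integral>\<^sup>+x. ennreal (unnorm_density \<A> m x) \<partial>region_lebesgue \<A> m) \<partial>count_space (models \<A>))"
    (is "_ = ?I h")
  using assms
proof (induction rule: borel_measurable_induct)
  case (cong f g)
  have "?I f = ?I g"
  proof (intro nn_integral_cong arg_cong2[where f="(/)"] arg_cong2[where f="(*)"] refl)
    fix m x assume "m \<in> space (count_space (models \<A>))" "x \<in> space (region_lebesgue \<A> m)"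
    then show "f (m, x) = g (m, x)"
      by (intro cong(3)) (simp add: space_state_space space_region_lebesgue)
  qed
  moreover have "(\<integral>\<^sup>+z. f z \<partial>target \<A>) = (\<integral>\<^sup>+z. g z \<partial>target \<A>)"
    by (rule nn_integral_cong) (simp add: cong(3) space_target)
  ultimately show ?case using cong by simp
next
  case (set E)
  then show ?case
    by (simp add: sets_target emeasure_target indicator_vimage[symmetric] o_def vimage_def)
next
  case (mult u c)
  have [measurable]: "(\<lambda>x. u (m, x)) \<in> borel_measurable (region_lebesgue \<A> m)"
    "(\<lambda>x. unnorm_density \<A> m x) \<in> borel_measurable (region_lebesgue \<A> m)"
    if "m \<in> models \<A>" for m
    using measurable_compose[OF measurable_Pair_model[OF that] mult(2)] density_measurable[OF that] by auto
  have "(\<integral>\<^sup>+z. c * u z \<partial>target \<A>) = c * (\<integral>\<^sup>+z. u z \<partial>target \<A>)"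
    by (rule nn_integral_cmult) (use mult in \<open>simp add: measurable_cong_sets[OF sets_target refl]\<close>)
  also have "\<dots> = c * ?I u" by (simp add: mult)
  also have "\<dots> = ?I (\<lambda>z. c * u z)"
    by (subst nn_integral_cmult[symmetric], simp, rule nn_integral_cong)
       (simp add: nn_integral_cmult[symmetric] divide_ennreal_def ac_simps)
  finally show ?case .
next
  case (add u v)
  have [measurable]: "(\<lambda>x. u (m, x)) \<in> borel_measurable (region_lebesgue \<A> m)"
    "(\<lambda>x. v (m, x)) \<in> borel_measurable (region_lebesgue \<A> m)"
    "(\<lambda>x. unnorm_density \<A> m x) \<in> borel_measurable (region_lebesgue \<A> m)"
    if "m \<in> models \<A>" for m
    using measurable_compose[OF measurable_Pair_model[OF that] \<open>u \<in> borel_measurable (state_space \<A>)\<close>]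
      measurable_compose[OF measurable_Pair_model[OF that] \<open>v \<in> borel_measurable (state_space \<A>)\<close>] density_measurable[OF that] by auto
  have "(\<integral>\<^sup>+z. v z + u z \<partial>target \<A>) = (\<integral>\<^sup>+z. v z \<partial>target \<A>) + (\<integral>\<^sup>+z. u z \<partial>target \<A>)"
    by (rule nn_integral_add) (use add in \<open>simp_all add: measurable_cong_sets[OF sets_target refl]\<close>)
  also have "\<dots> = ?I v + ?I u" by (simp add: add)
  also have "\<dots> = ?I (\<lambda>z. v z + u z)"
    by (subst nn_integral_add[symmetric], simp, simp, rule nn_integral_cong)
       (simp add: distrib_left nn_integral_add divide_ennreal_def distrib_right)
  finally show ?case .
next
  case (seq U)
  have [measurable]: "(\<lambda>x. U i (m, x)) \<in> borel_measurable (region_lebesgue \<A> m)"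
    "(\<lambda>x. unnorm_density \<A> m x) \<in> borel_measurable (region_lebesgue \<A> m)"
    if "m \<in> models \<A>" for m i
    using measurable_compose[OF measurable_Pair_model[OF that] seq(1)] density_measurable[OF that] by auto
  \<comment> \<open>The supremum has to pass both the integral over a region and the sum over the
    models; each passage needs its own increasing sequence.\<close>
  have inc: "incseq (\<lambda>i x. ennreal (unnorm_density \<A> m x) * U i (m, x))" for m
    using seq(3) by (auto simp: incseq_def le_fun_def intro!: mult_left_mono)
  have inc': "incseq (\<lambda>i m. ennreal (model_weight \<A> m) *
      (\<integral>\<^sup>+x. ennreal (unnorm_density \<A> m x) * U i (m, x) \<partial>region_lebesgue \<A> m) /
      (\<integral>\<^sup>+x. ennreal (unnorm_density \<A> m x) \<partial>region_lebesgue \<A> m))"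
    using seq(3) unfolding incseq_def le_fun_def divide_ennreal_def
    by (intro allI impI mult_right_mono mult_left_mono nn_integral_mono) auto
  have "(\<integral>\<^sup>+z. (SUP i. U i z) \<partial>target \<A>) = (SUP i. \<integral>\<^sup>+z. U i z \<partial>target \<A>)"
    by (rule nn_integral_monotone_convergence_SUP)
       (use seq in \<open>simp_all add: measurable_cong_sets[OF sets_target refl]\<close>)
  also have "\<dots> = (SUP i. ?I (U i))" by (simp add: seq)
  also have "\<dots> = ?I (\<lambda>z. SUP i. U i z)"
    by (subst nn_integral_monotone_convergence_SUP[OF inc', symmetric], simp, rule nn_integral_cong)
       (simp add: SUP_mult_left_ennreal nn_integral_monotone_convergence_SUP[OF inc] divide_ennreal_def
          flip: SUP_mult_right_ennreal)
  finally show ?case by (simp add: image_comp)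
qed

text \<open>Positive weights and densities make Lebesgue measure on each region absolutely
  continuous with respect to the target. Hence a proposal with a Lebesgue density almost surely
  avoids target-null sets.\<close>

lemma AE_target_slice:
  assumes E: "E \<in> sets (state_space \<A>)" and null: "emeasure (target \<A>) E = 0" and m: "m \<in> models \<A>"
  shows "AE x in region_lebesgue \<A> m. (m, x) \<notin> E"
proof -
  let ?L = "region_lebesgue \<A> m"
  let ?f = "\<lambda>x. ennreal (unnorm_density \<A> m x)"
  let ?B = "Pair m -` E \<inter> space ?L"
  have B: "?B \<in> sets ?L" by (rule sets_slice[OF m E])
  have "{m} \<times> ?B \<subseteq> E" by auto
  then have "emeasure (target \<A>) ({m} \<times> ?B) \<le> emeasure (target \<A>) E"
    by (rule emeasure_mono) (simp add: sets_target E)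
  then have "ennreal (model_weight \<A> m) * (\<integral>\<^sup>+x\<in>?B. ?f x \<partial>?L) / (\<integral>\<^sup>+x. ?f x \<partial>?L) = 0"
    using null by (simp add: emeasure_target_Times[OF m B])
  \<comment> \<open>An \<open>ennreal\<close> quotient also vanishes when its denominator is
    infinite, which finiteness of the normalising integral rules out.\<close>
  then have "(\<integral>\<^sup>+x\<in>?B. ?f x \<partial>?L) = 0"
    using weight_bounds[OF m] density_integral_finite[OF m]
    by (auto simp: divide_ennreal_def ennreal_inverse_eq_0_iff ennreal_eq_0_iff)
  then have "AE x in ?L. ?f x * indicator ?B x = 0"
    using density_measurable[OF m] B by (subst (asm) nn_integral_0_iff_AE) auto
  with AE_space show ?thesis
  proof eventually_elim
    case (elim x)
    then have "?f x \<noteq> 0"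
      using density_pos[OF m, of x] by (simp add: space_region_lebesgue[OF m] ennreal_eq_0_iff not_le)
    with elim show ?case by (auto split: split_indicator_asm)
  qed
qed

lemma within_accept_measurable:
  assumes m: "m \<in> models \<A>"
  shows "(\<lambda>(x, y). within_accept \<A> m x y)
    \<in> borel_measurable (region_lebesgue \<A> m \<Otimes>\<^sub>M region_lebesgue \<A> m)"
proof -
  let ?L = "region_lebesgue \<A> m"
  have q: "(\<lambda>w. within_proposal \<A> m (fst w) (snd w)) \<in> borel_measurable (?L \<Otimes>\<^sub>M ?L)"
    using within_proposal_measurable[OF m] by (simp add: split_beta)
  have "(\<lambda>w. within_proposal \<A> m (snd w) (fst w)) \<in> borel_measurable (?L \<Otimes>\<^sub>M ?L)"
    using measurable_compose[OF measurable_pair_swap' q] by (simp add: split_beta)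
  note [measurable] = q this measurable_compose[OF measurable_fst density_measurable[OF m]]
    measurable_compose[OF measurable_snd density_measurable[OF m]]
  show ?thesis
    unfolding within_accept_def Let_def split_beta by measurable
qed

lemma within_accept_bounds:
  assumes "m \<in> models \<A>" "x \<in> param_region \<A> m" "y \<in> param_region \<A> m"
  shows "0 \<le> within_accept \<A> m x y" "within_accept \<A> m x y \<le> 1"
  using assms density_pos[of m] within_proposal_nonneg[of m]
  by (auto simp: within_accept_def Let_def min_def less_imp_le intro!: divide_nonneg_nonneg mult_nonneg_nonneg)

text \<open>Used for two kinds of sets: \<open>E \<times> UNIV\<close>, which forgets the flag, for
  invariance, and \<open>N \<times> {True}\<close>, which removes the atom at \<open>x\<close> left
  by rejections, for absolute continuity.\<close>

lemma emeasure_within_step: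
  assumes m: "m \<in> models \<A>" and x: "x \<in> param_region \<A> m" and E: "E \<in> sets (flagged_space \<A>)"
  shows "emeasure (within_step \<A> (m, x)) E =
    (\<integral>\<^sup>+y. ennreal (within_proposal \<A> m x y) *
       (ennreal (within_accept \<A> m x y) * indicator E ((m, y), True) +
        ennreal (1 - within_accept \<A> m x y) * indicator E ((m, x), False)) \<partial>region_lebesgue \<A> m)"
proof -
  let ?L = "region_lebesgue \<A> m"
  let ?q = "\<lambda>y. ennreal (within_proposal \<A> m x y)"
  let ?h = "\<lambda>y b. if b then ((m, y), True) else ((m, x), False)"
  let ?G = "\<lambda>y. measure_pmf (bernoulli_pmf (within_accept \<A> m x y)) \<bind>
      (\<lambda>b. return (flagged_space \<A>) (?h y b))"
  have xL: "x \<in> space ?L" using x by (simp add: space_region_lebesgue[OF m])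
  have q: "?q \<in> borel_measurable ?L"
    using measurable_Pair2[OF within_proposal_measurable[OF m] xL] by simp
  have acc: "(\<lambda>y. within_accept \<A> m x y) \<in> borel_measurable ?L"
    using measurable_Pair2[OF within_accept_measurable[OF m] xL] by simp
  have D: "density ?L ?q \<in> space (prob_algebra ?L)"
    by (rule measurable_space[OF within_density_kernel[OF m] xL])
  have pr: "(\<lambda>v. (m, fst v)) \<in> ?L \<Otimes>\<^sub>M count_space (UNIV :: bool set) \<rightarrow>\<^sub>M state_space \<A>"
    by (rule measurable_compose[OF measurable_fst measurable_Pair_model[OF m]])
  have mx: "(m, x) \<in> space (state_space \<A>)" using m x by (simp add: space_state_space)
  have "(\<lambda>v. return (flagged_space \<A>) (if snd v then ((m, fst v), True) else ((m, x), False)))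
      \<in> ?L \<Otimes>\<^sub>M count_space UNIV \<rightarrow>\<^sub>M prob_algebra (flagged_space \<A>)"
    by (rule measurable_compose[OF _ measurable_return_prob_space], rule measurable_If)
       (use pr mx in \<open>auto intro!: measurable_Pair\<close>)
  then have G: "?G \<in> ?L \<rightarrow>\<^sub>M prob_algebra (flagged_space \<A>)"
    by (intro measurable_bind_prob_space2[OF measurable_compose[OF acc bernoulli_pmf_kernel]])
       (simp add: split_beta)
  have G_eq: "emeasure (?G y) E = ennreal (within_accept \<A> m x y) * indicator E ((m, y), True) +
        ennreal (1 - within_accept \<A> m x y) * indicator E ((m, x), False)"
    if "y \<in> space ?L" for y
    using that m x within_accept_bounds[OF m x, of y]
    by (subst emeasure_bernoulli_bind_return[OF _ _ _ E])
       (auto simp: space_region_lebesgue[OF m] space_pair_measure space_state_space)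
  have "emeasure (within_step \<A> (m, x)) E = (\<integral>\<^sup>+y. emeasure (?G y) E \<partial>density ?L ?q)"
    unfolding within_step_def prod.case by (rule emeasure_bind_prob_algebra[OF D G E])
  also have "\<dots> = (\<integral>\<^sup>+y. ?q y * emeasure (?G y) E \<partial>?L)"
    by (rule nn_integral_density[OF q])
       (rule measurable_emeasure_kernel[OF measurable_prob_algebraD[OF G] E])
  also have "\<dots> = (\<integral>\<^sup>+y. ?q y *
       (ennreal (within_accept \<A> m x y) * indicator E ((m, y), True) +
        ennreal (1 - within_accept \<A> m x y) * indicator E ((m, x), False)) \<partial>?L)"
    by (rule nn_integral_cong) (simp only: G_eq)
  finally show ?thesis .
qed

lemma emeasure_flagged_step:
  assumes z: "z \<in> space (state_space \<A>)" and E: "E \<in> sets (flagged_space \<A>)"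
  shows "emeasure (flagged_step \<A> z) E =
    ennreal (between_prob \<A>) * emeasure (between_step \<A> z) ((\<lambda>z'. (z', False)) -` E \<inter> space (state_space \<A>)) +
    ennreal (1 - between_prob \<A>) * emeasure (within_step \<A> z) E"
proof -
  let ?k = "\<lambda>b. if b then distr (between_step \<A> z) (flagged_space \<A>) (\<lambda>z'. (z', False))
       else within_step \<A> z"
  have between: "between_step \<A> z \<in> space (prob_algebra (state_space \<A>))"
    by (rule measurable_space[OF between_step_kernel z])
  then have sets_between: "sets (between_step \<A> z) = sets (state_space \<A>)"
    by (simp add: space_prob_algebra)
  have False_meas: "(\<lambda>z'. (z', False)) \<in> between_step \<A> z \<rightarrow>\<^sub>M flagged_space \<A>"
    unfolding measurable_cong_sets[OF sets_between refl] by measurable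
  have "?k b \<in> space (prob_algebra (flagged_space \<A>))" for b
    using between measurable_space[OF within_step_kernel z] False_meas
    by (auto simp: space_prob_algebra intro!: prob_space.prob_space_distr)
  then have k: "?k \<in> count_space UNIV \<rightarrow>\<^sub>M prob_algebra (flagged_space \<A>)"
    by simp
  have "emeasure (flagged_step \<A> z) E = (\<integral>\<^sup>+b. emeasure (?k b) E \<partial>measure_pmf (bernoulli_pmf (between_prob \<A>)))"
    unfolding flagged_step_def
    by (rule emeasure_bind_prob_algebra[OF _ k E])
       (simp add: space_prob_algebra measure_pmf.prob_space_axioms)
  also have "\<dots> = ennreal (between_prob \<A>) * emeasure (?k True) E +
      ennreal (1 - between_prob \<A>) * emeasure (?k False) E"
    using between_prob_bounds by (simp add: mult.commute)
  also have "emeasure (?k True) E =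
      emeasure (between_step \<A> z) ((\<lambda>z'. (z', False)) -` E \<inter> space (state_space \<A>))"
    using sets_eq_imp_space_eq[OF sets_between] by (simp add: emeasure_distr[OF False_meas E])
  finally show ?thesis by simp
qed

lemma emeasure_mcmc_kernel:
  assumes z: "z \<in> space (state_space \<A>)" and E: "E \<in> sets (state_space \<A>)"
  shows "emeasure (mcmc_kernel \<A> z) E =
    ennreal (between_prob \<A>) * emeasure (between_step \<A> z) E +
    ennreal (1 - between_prob \<A>) * emeasure (within_step \<A> z) (E \<times> UNIV)"
proof -
  have sets: "sets (flagged_step \<A> z) = sets (flagged_space \<A>)"
    using measurable_space[OF flagged_step_kernel z] by (simp add: space_prob_algebra)
  have fst: "fst \<in> flagged_step \<A> z \<rightarrow>\<^sub>M state_space \<A>"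
    unfolding measurable_cong_sets[OF sets refl] by measurable
  have EU: "E \<times> UNIV \<in> sets (flagged_space \<A>)" using E by auto
  have "fst -` E \<inter> space (flagged_step \<A> z) = E \<times> UNIV"
    using sets.sets_into_space[OF E] sets_eq_imp_space_eq[OF sets] by (auto simp: space_pair_measure)
  then have "emeasure (mcmc_kernel \<A> z) E = emeasure (flagged_step \<A> z) (E \<times> UNIV)"
    unfolding mcmc_kernel_def by (simp add: emeasure_distr[OF fst E])
  moreover have "(\<lambda>z'. (z', False)) -` (E \<times> UNIV) \<inter> space (state_space \<A>) = E"
    using sets.sets_into_space[OF E] by auto
  ultimately show ?thesis by (simp add: emeasure_flagged_step[OF z EU])
qed

text \<open>Detailed balance: the accepted flow from \<open>x\<close> to \<open>y\<close> has the
  symmetric density min(f(x) q(x,y), f(y) q(y,x)), and rejected mass stays in place.\<close>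

lemma within_step_stationary:
  assumes E: "E \<in> sets (state_space \<A>)"
  shows "(\<integral>\<^sup>+z. emeasure (within_step \<A> z) (E \<times> UNIV) \<partial>target \<A>) = emeasure (target \<A>) E"
proof -
  have EU: "E \<times> UNIV \<in> sets (flagged_space \<A>)" using E by auto
  have meas: "(\<lambda>z. emeasure (within_step \<A> z) (E \<times> UNIV)) \<in> borel_measurable (state_space \<A>)"
    by (rule measurable_emeasure_kernel[OF measurable_prob_algebraD[OF within_step_kernel] EU])
  have main: "(\<integral>\<^sup>+x. ennreal (unnorm_density \<A> m x) * emeasure (within_step \<A> (m, x)) (E \<times> UNIV)
        \<partial>region_lebesgue \<A> m) =
      (\<integral>\<^sup>+x\<in>Pair m -` E. ennreal (unnorm_density \<A> m x) \<partial>region_lebesgue \<A> m)"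
    if m: "m \<in> models \<A>" for m
  proof -
    let ?L = "region_lebesgue \<A> m"
    let ?f = "unnorm_density \<A> m" and ?q = "within_proposal \<A> m" and ?\<alpha> = "within_accept \<A> m"
    define B where "B = Pair m -` E \<inter> space ?L"
    have B [measurable]: "B \<in> sets ?L" unfolding B_def by (rule sets_slice[OF m E])
    \<comment> \<open>Densities of the accepted flow from \<open>x\<close> to \<open>y\<close> and
      of the mass held back at \<open>x\<close> when \<open>y\<close> is rejected.\<close>
    define s where "s x y = ennreal (?f x * ?q x y * ?\<alpha> x y)" for x y
    define r where "r x y = ennreal (?f x * ?q x y * (1 - ?\<alpha> x y))" for x y
    have q: "(\<lambda>w. ?q (fst w) (snd w)) \<in> borel_measurable (?L \<Otimes>\<^sub>M ?L)"
      using within_proposal_measurable[OF m] by (simp add: split_beta)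
    have \<alpha>: "(\<lambda>w. ?\<alpha> (fst w) (snd w)) \<in> borel_measurable (?L \<Otimes>\<^sub>M ?L)"
      using within_accept_measurable[OF m] by (simp add: split_beta)
    note [measurable] = q \<alpha> density_measurable[OF m]
      measurable_compose[OF measurable_fst density_measurable[OF m]]
    have s: "(\<lambda>w. s (fst w) (snd w)) \<in> borel_measurable (?L \<Otimes>\<^sub>M ?L)"
      unfolding s_def by measurable
    have r: "(\<lambda>w. r (fst w) (snd w)) \<in> borel_measurable (?L \<Otimes>\<^sub>M ?L)"
      unfolding r_def by measurable
    note [measurable] = s r
    interpret sigma_finite_measure ?L by (rule sigma_finite_region_lebesgue[OF m])
    interpret pair_sigma_finite ?L ?L ..
    have sym: "s x y = s y x" if "x \<in> space ?L" "y \<in> space ?L" for x y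
    proof -
      have "?f x * ?q x y * ?\<alpha> x y = min (?f x * ?q x y) (?f y * ?q y x)"
        if "x \<in> param_region \<A> m" "y \<in> param_region \<A> m" for x y
      proof (cases "?f x * ?q x y = 0")
        \<comment> \<open>The convention of accepting with probability 1 at a zero denominator is
          harmless: the flow is 0, and so is the minimum, as the reverse term is
          nonnegative.\<close>
        case True
        have "0 \<le> ?f y * ?q y x"
          using that density_pos[OF m] within_proposal_nonneg[OF m] by (simp add: less_imp_le)
        then show ?thesis unfolding True by simp
      next
        case False
        then have "?f x * ?q x y > 0"
          using that density_pos[OF m] within_proposal_nonneg[OF m]
          by (simp add: less_le)
        moreover have "d * min 1 (n / d) = min d n" if "d > 0" for d n :: real
          using that by (simp add: min_def field_simps)
        ultimately have "?f x * ?q x y * min 1 (?f y * ?q y x / (?f x * ?q x y)) =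
            min (?f x * ?q x y) (?f y * ?q y x)" by blast
        with False show ?thesis
          unfolding within_accept_def Let_def by (simp only: if_False)
      qed
      then show ?thesis
        using that by (simp add: s_def space_region_lebesgue[OF m] min.commute)
    qed
    have "(\<integral>\<^sup>+x. ennreal (?f x) * emeasure (within_step \<A> (m, x)) (E \<times> UNIV) \<partial>?L) =
        (\<integral>\<^sup>+x. (\<integral>\<^sup>+y. s x y * indicator B y \<partial>?L) + (\<integral>\<^sup>+y. r x y * indicator B x \<partial>?L) \<partial>?L)"
    proof (rule nn_integral_cong)
      fix x assume x: "x \<in> space ?L"
      then have x': "x \<in> param_region \<A> m" by (simp add: space_region_lebesgue[OF m])
      have [measurable]: "(\<lambda>y. s x y) \<in> borel_measurable ?L" "(\<lambda>y. r x y) \<in> borel_measurable ?L"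
        "(\<lambda>y. ?q x y) \<in> borel_measurable ?L" "(\<lambda>y. ?\<alpha> x y) \<in> borel_measurable ?L"
        using measurable_Pair2[OF s x] measurable_Pair2[OF r x] measurable_Pair2[OF q x]
          measurable_Pair2[OF \<alpha> x] by simp_all
      have "emeasure (within_step \<A> (m, x)) (E \<times> UNIV) = (\<integral>\<^sup>+y. ennreal (?q x y) *
          (ennreal (?\<alpha> x y) * indicator B y + ennreal (1 - ?\<alpha> x y) * indicator B x) \<partial>?L)"
        unfolding emeasure_within_step[OF m x' EU]
        by (rule nn_integral_cong) (auto simp: B_def x split: split_indicator)
      then have "ennreal (?f x) * emeasure (within_step \<A> (m, x)) (E \<times> UNIV) =
        (\<integral>\<^sup>+y. ennreal (?f x) * (ennreal (?q x y) *
          (ennreal (?\<alpha> x y) * indicator B y + ennreal (1 - ?\<alpha> x y) * indicator B x)) \<partial>?L)"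
        by (simp add: nn_integral_cmult)
      also have "\<dots> = (\<integral>\<^sup>+y. s x y * indicator B y + r x y * indicator B x \<partial>?L)"
      proof (rule nn_integral_cong)
        fix y assume "y \<in> space ?L"
        then have y: "y \<in> param_region \<A> m" by (simp add: space_region_lebesgue[OF m])
        have "0 \<le> ?f x" "0 \<le> ?q x y"
          using density_pos[OF m x'] within_proposal_nonneg[OF m x' y] by simp_all
        then show "ennreal (?f x) * (ennreal (?q x y) *
          (ennreal (?\<alpha> x y) * indicator B y + ennreal (1 - ?\<alpha> x y) * indicator B x)) =
          s x y * indicator B y + r x y * indicator B x"
          using within_accept_bounds[OF m x' y]
          by (auto simp: s_def r_def ennreal_mult distrib_left mult.assoc split: split_indicator)
      qed
      also have "\<dots> = (\<integral>\<^sup>+y. s x y * indicator B y \<partial>?L) + (\<integral>\<^sup>+y. r x y * indicator B x \<partial>?L)"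
        by (rule nn_integral_add) auto
      finally show "ennreal (?f x) * emeasure (within_step \<A> (m, x)) (E \<times> UNIV) = \<dots>" .
    qed
    also have "\<dots> = (\<integral>\<^sup>+x. (\<integral>\<^sup>+y. s x y * indicator B y \<partial>?L) \<partial>?L) +
        (\<integral>\<^sup>+x. (\<integral>\<^sup>+y. r x y * indicator B x \<partial>?L) \<partial>?L)"
      by (rule nn_integral_add) measurable
    \<comment> \<open>Fubini and the symmetry of \<open>s\<close> turn the accepted flow into
      \<open>B\<close> into the accepted flow starting in \<open>B\<close>.\<close>
    also have "(\<integral>\<^sup>+x. (\<integral>\<^sup>+y. s x y * indicator B y \<partial>?L) \<partial>?L) =
        (\<integral>\<^sup>+y. (\<integral>\<^sup>+x. s x y * indicator B y \<partial>?L) \<partial>?L)"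
      by (rule Fubini'[symmetric]) measurable
    also have "\<dots> = (\<integral>\<^sup>+x. (\<integral>\<^sup>+y. s x y * indicator B x \<partial>?L) \<partial>?L)"
      by (intro nn_integral_cong) (simp add: sym)
    also have "\<dots> + (\<integral>\<^sup>+x. (\<integral>\<^sup>+y. r x y * indicator B x \<partial>?L) \<partial>?L) =
        (\<integral>\<^sup>+x. (\<integral>\<^sup>+y. s x y * indicator B x \<partial>?L) + (\<integral>\<^sup>+y. r x y * indicator B x \<partial>?L) \<partial>?L)"
      by (rule nn_integral_add[symmetric]) measurable
    also have "\<dots> = (\<integral>\<^sup>+x\<in>B. ennreal (?f x) \<partial>?L)"
    proof (rule nn_integral_cong)
      fix x assume x: "x \<in> space ?L"
      then have x': "x \<in> param_region \<A> m" by (simp add: space_region_lebesgue[OF m])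
      have [measurable]: "(\<lambda>y. s x y) \<in> borel_measurable ?L" "(\<lambda>y. r x y) \<in> borel_measurable ?L"
        "(\<lambda>y. ?q x y) \<in> borel_measurable ?L"
        using measurable_Pair2[OF s x] measurable_Pair2[OF r x] measurable_Pair2[OF q x] by simp_all
      have "(\<integral>\<^sup>+y. s x y * indicator B x \<partial>?L) + (\<integral>\<^sup>+y. r x y * indicator B x \<partial>?L) =
          (\<integral>\<^sup>+y. s x y * indicator B x + r x y * indicator B x \<partial>?L)"
        by (rule nn_integral_add[symmetric]) auto
      \<comment> \<open>Accepted and rejected parts add up to f(x) q(x,y), whose integral over
        \<open>y\<close> is f(x).\<close>
      also have "\<dots> = (\<integral>\<^sup>+y. (ennreal (?f x) * indicator B x) * ennreal (?q x y) \<partial>?L)"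
      proof (rule nn_integral_cong)
        fix y assume "y \<in> space ?L"
        then have y: "y \<in> param_region \<A> m" by (simp add: space_region_lebesgue[OF m])
        have nn: "0 \<le> ?f x" "0 \<le> ?q x y"
          using density_pos[OF m x'] within_proposal_nonneg[OF m x' y] by simp_all
        have "s x y + r x y = ennreal (?f x * ?q x y * ?\<alpha> x y + ?f x * ?q x y * (1 - ?\<alpha> x y))"
          unfolding s_def r_def
          using nn within_accept_bounds[OF m x' y] by (intro ennreal_plus[symmetric]) auto
        also have "\<dots> = ennreal (?f x) * ennreal (?q x y)"
          using nn by (simp add: ennreal_mult algebra_simps)
        finally show "s x y * indicator B x + r x y * indicator B x =
            (ennreal (?f x) * indicator B x) * ennreal (?q x y)"
          by (auto split: split_indicator)
      qed
      also have "\<dots> = ennreal (?f x) * indicator B x"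
        using within_proposal_integral[OF m x'] by (subst nn_integral_cmult) auto
      finally show "(\<integral>\<^sup>+y. s x y * indicator B x \<partial>?L) + (\<integral>\<^sup>+y. r x y * indicator B x \<partial>?L) =
          ennreal (?f x) * indicator B x" .
    qed
    also have "\<dots> = (\<integral>\<^sup>+x\<in>Pair m -` E. ennreal (?f x) \<partial>?L)"
      by (rule nn_integral_cong) (auto simp: B_def split: split_indicator)
    finally show ?thesis .
  qed
  show ?thesis
    unfolding nn_integral_target[OF meas] emeasure_target[OF E]
    by (rule nn_integral_cong) (simp add: main)
qed

text \<open>A mixture of two kernels that both preserve the target: the between-model step by
  assumption, the within-model step by detailed balance.\<close>

lemma mcmc_kernel_stationary: "stationary (state_space \<A>) (mcmc_kernel \<A>) (target \<A>)"
proof -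
  have "(\<integral>\<^sup>+z. emeasure (mcmc_kernel \<A> z) E \<partial>target \<A>) = emeasure (target \<A>) E"
    if E: "E \<in> sets (state_space \<A>)" for E
  proof -
    let ?a = "between_prob \<A>"
    have EU: "E \<times> UNIV \<in> sets (flagged_space \<A>)" using E by auto
    have 1: "(\<lambda>z. emeasure (within_step \<A> z) (E \<times> UNIV)) \<in> borel_measurable (target \<A>)"
      unfolding measurable_cong_sets[OF sets_target refl]
      by (rule measurable_emeasure_kernel[OF measurable_prob_algebraD[OF within_step_kernel] EU])
    have 2: "(\<lambda>z. emeasure (between_step \<A> z) E) \<in> borel_measurable (target \<A>)"
      unfolding measurable_cong_sets[OF sets_target refl]
      by (rule measurable_emeasure_kernel[OF measurable_prob_algebraD[OF between_step_kernel] E])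
    have "(\<integral>\<^sup>+z. emeasure (mcmc_kernel \<A> z) E \<partial>target \<A>) =
       (\<integral>\<^sup>+z. ennreal ?a * emeasure (between_step \<A> z) E +
          ennreal (1 - ?a) * emeasure (within_step \<A> z) (E \<times> UNIV) \<partial>target \<A>)"
      by (rule nn_integral_cong) (simp add: emeasure_mcmc_kernel[OF _ E] space_target)
    also have "\<dots> = ennreal ?a * (\<integral>\<^sup>+z. emeasure (between_step \<A> z) E \<partial>target \<A>) +
        ennreal (1 - ?a) * (\<integral>\<^sup>+z. emeasure (within_step \<A> z) (E \<times> UNIV) \<partial>target \<A>)"
      using 1 2 by (simp add: nn_integral_add nn_integral_cmult)
    also have "\<dots> = (ennreal ?a + ennreal (1 - ?a)) * emeasure (target \<A>) E"
      using between_step_stationary E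
      by (simp add: within_step_stationary[OF E] stationary_def distrib_right)
    also have "ennreal ?a + ennreal (1 - ?a) = 1"
      using between_prob_bounds by (simp add: ennreal_plus[symmetric] del: ennreal_plus)
    finally show ?thesis by simp
  qed
  then show ?thesis
    using between_step_stationary by (simp add: stationary_def)
qed

section \<open>Accepted within-model moves avoid null sets\<close>

lemma AE_flagged_step_accepted:
  assumes N: "N \<in> null_sets (target \<A>)" and z: "z \<in> space (state_space \<A>)"
  shows "AE w in flagged_step \<A> z. \<not> (snd w \<and> fst w \<in> N)"
proof -
  have N': "N \<in> sets (state_space \<A>)" "emeasure (target \<A>) N = 0"
    using N by (auto simp: null_sets_def sets_target)
  obtain m x where mx: "z = (m, x)" "m \<in> models \<A>" "x \<in> param_region \<A> m"
    using z by (auto simp: space_state_space)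
  let ?E = "N \<times> {True}"
  have E: "?E \<in> sets (flagged_space \<A>)" using N' by auto
  \<comment> \<open>Requiring the flag \<open>True\<close> leaves only the accepted part, an
    integral against Lebesgue measure over a null slice.\<close>
  have "emeasure (within_step \<A> z) ?E = (\<integral>\<^sup>+y. 0 \<partial>region_lebesgue \<A> m)"
    unfolding mx(1) emeasure_within_step[OF mx(2,3) E]
    by (rule nn_integral_cong_AE)
       (use AE_target_slice[OF N' mx(2)] in eventually_elim, simp)
  \<comment> \<open>Between-model moves always carry the flag \<open>False\<close>, so they put no
    mass on \<open>?E\<close>.\<close>
  then have "emeasure (flagged_step \<A> z) ?E = 0"
    by (simp add: emeasure_flagged_step[OF z E] vimage_def)
  then have "?E \<in> null_sets (flagged_step \<A> z)"
    using measurable_space[OF flagged_step_kernel z] E by (simp add: null_sets_def space_prob_algebra)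
  from AE_not_in[OF this] show ?thesis
    by eventually_elim (auto simp: mem_Times_iff)
qed

text \<open>No strong Markov property is needed: the bound goes through the recursions for both
  probabilities, because an accepted move to a point where \<open>hit_prob\<close> is below 1 has probability 0.\<close>

lemma hit_within_flag_le_hit_prob:
  assumes A: "A \<in> sets (state_space \<A>)"
    and ae: "AE z in target \<A>. hit_prob (mcmc_kernel \<A>) A z = 1"
    and z: "z \<in> space (state_space \<A>)"
  shows "hit_within (\<lambda>(z', _). flagged_step \<A> z') (space (state_space \<A>) \<times> {True}) n (z, b)
    \<le> hit_prob (mcmc_kernel \<A>) A z"
  using z
proof (induction n arbitrary: z b)
  case (Suc n)
  interpret M: markov_kernel "state_space \<A>" "mcmc_kernel \<A>"
    by unfold_locales (rule mcmc_kernel_kernel)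
  let ?g = "hit_prob (mcmc_kernel \<A>) A"
  let ?G = "hit_within (\<lambda>(z', _). flagged_step \<A> z') (space (state_space \<A>) \<times> {True})"
  interpret F: markov_kernel "flagged_space \<A>" "\<lambda>(z', _). flagged_step \<A> z'"
    by unfold_locales (use measurable_compose[OF measurable_fst flagged_step_kernel] in \<open>simp add: split_beta'\<close>)
  let ?N = "{z \<in> space (state_space \<A>). ?g z \<noteq> 1}"
  have N: "?N \<in> sets (state_space \<A>)"
    using M.measurable_hit_prob[OF A] by measurable
  have "?N \<in> null_sets (target \<A>)"
    using ae N by (subst (asm) AE_iff_null) (auto simp: space_target sets_target)
  note accepted = AE_flagged_step_accepted[OF this Suc.prems]
  have sets: "sets (flagged_step \<A> z) = sets (flagged_space \<A>)"
    using measurable_space[OF flagged_step_kernel Suc.prems] by (simp add: space_prob_algebra)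
  have fst: "fst \<in> flagged_step \<A> z \<rightarrow>\<^sub>M state_space \<A>"
    unfolding measurable_cong_sets[OF sets refl] by measurable
  have "?G (Suc n) (z, b) =
      (\<integral>\<^sup>+w. (if w \<in> space (state_space \<A>) \<times> {True} then 1 else ?G n w) \<partial>flagged_step \<A> z)"
    by simp
  \<comment> \<open>For flag \<open>True\<close> the left integrand is 1, but almost surely the new
    state lies outside \<open>?N\<close>, where \<open>?g\<close> is 1 as well. For flag
    \<open>False\<close> the induction hypothesis applies unless the state is in \<open>A\<close>,
    where the right integrand is 1.\<close>
  also have "\<dots> \<le> (\<integral>\<^sup>+w. (if fst w \<in> A then 1 else ?g (fst w)) \<partial>flagged_step \<A> z)"
  proof (rule nn_integral_mono_AE)
    show "AE w in flagged_step \<A> z. (if w \<in> space (state_space \<A>) \<times> {True} then 1 else ?G n w)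
        \<le> (if fst w \<in> A then 1 else ?g (fst w))"
      using accepted AE_space
    proof eventually_elim
      case (elim w)
      then have w: "w \<in> space (flagged_space \<A>)" "fst w \<in> space (state_space \<A>)"
        using sets_eq_imp_space_eq[OF sets] by (auto simp: space_pair_measure)
      show ?case
        using elim w Suc.IH[OF w(2), of "snd w"] F.hit_within_le_1[OF w(1)] by (auto simp: mem_Times_iff)
    qed
  qed
  \<comment> \<open>The integrand depends on the state alone, so the flag can be projected away and
    first-step analysis of the unflagged chain closes the recursion.\<close>
  also have "\<dots> = (\<integral>\<^sup>+y. (if y \<in> A then 1 else ?g y) \<partial>mcmc_kernel \<A> z)"
    unfolding mcmc_kernel_def[of \<A> z]
    by (rule nn_integral_distr[OF fst, symmetric]) (use A M.measurable_hit_prob[OF A] in measurable)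
  also have "\<dots> = ?g z" by (rule M.hit_prob_step[OF A Suc.prems, symmetric])
  finally show ?case .
qed simp

end

section \<open>Harris recurrence from every starting point\<close>

theorem theorem20:
  fixes \<A> :: "'u trans_dim_mcmc"
  assumes "full_dim_trans_dim_mcmc \<A>"
    and "phi_irreducible (state_space \<A>) (mcmc_kernel \<A>)"
    and "\<forall>m\<in>models \<A>. \<forall>x\<in>param_region \<A> m.
           \<P>(\<omega> in flagged_law \<A> (m, x). no_within_move_accepted \<omega>) = 0"
  shows "harris_recurrent (state_space \<A>) (mcmc_kernel \<A>) (target \<A>)"
proof -
  interpret full_dim_trans_dim_mcmc \<A> by fact
  let ?S = "state_space \<A>" and ?K = "mcmc_kernel \<A>"
  interpret M: stationary_markov_kernel ?S ?K "target \<A>"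
    by unfold_locales (rule mcmc_kernel_kernel mcmc_kernel_stationary)+
  let ?F = "\<lambda>(z', _ :: bool). flagged_step \<A> z'"
  interpret F: markov_kernel "flagged_space \<A>" ?F
    by unfold_locales (use measurable_compose[OF measurable_fst flagged_step_kernel] in \<open>simp add: split_beta'\<close>)
  have flag: "space ?S \<times> {True} \<in> sets (flagged_space \<A>)" by auto
  \<comment> \<open>The assumption on the event of no acceptance, restated as certain hitting of the
    flag \<open>True\<close> by the flagged chain.\<close>
  have flag_hit: "hit_prob ?F (space ?S \<times> {True}) (z, False) = 1" if z: "z \<in> space ?S" for z
  proof -
    let ?law = "chain_law (flagged_space \<A>) ?F (z, False)"
    let ?H = "{\<omega> \<in> space ?law. hitting_time (space ?S \<times> {True}) \<omega> < \<infinity>}"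
    have z': "(z, False) \<in> space (flagged_space \<A>)" using z by (simp add: space_pair_measure)
    note law = F.chain_law_hitting_time[OF flag z']
    interpret law: prob_space ?law by (rule law(1))
    \<comment> \<open>Both events look at times \<open>n \<ge> 1\<close> only, so the meaningless
      flag at time 0 enters neither of them.\<close>
    have "{\<omega> \<in> space ?law. no_within_move_accepted \<omega>} = space ?law - ?H"
    proof -
      have "\<omega> n \<in> space ?S \<times> {True} \<longleftrightarrow> snd (\<omega> n)" if "\<omega> \<in> space ?law" for \<omega> n
      proof -
        have "\<omega> n \<in> space (flagged_space \<A>)"
          using that unfolding law(2) by (auto simp: space_PiM)
        then show ?thesis by (auto simp: space_pair_measure mem_Times_iff)
      qed
      then show ?thesis
        unfolding hitting_time_finite_iff no_within_move_accepted_def by auto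
    qed
    moreover have "law.prob {\<omega> \<in> space ?law. no_within_move_accepted \<omega>} = 0"
      using assms(3) z by (auto simp: flagged_law_def space_state_space)
    \<comment> \<open>Measurability of \<open>?H\<close> matters here, since a value 0 of
      \<open>prob\<close> on a non-measurable set would say nothing about the complement.\<close>
    ultimately have "law.prob ?H = 1"
      using law.prob_compl[OF law(3)] by simp
    then show ?thesis
      using law(4) by (simp add: law.emeasure_eq_measure)
  qed
  have "\<P>(\<omega> in chain_law ?S ?K z. hitting_time A \<omega> < \<infinity>) = 1"
    if A: "A \<in> sets ?S" "emeasure (target \<A>) A > 0" and z: "z \<in> space ?S" for A z
  proof -
    note law = M.chain_law_hitting_time[OF A(1) z]
    interpret law: prob_space "chain_law ?S ?K z" by (rule law(1))
    \<comment> \<open>The 1 is the probability of ever accepting a within-model move; at each finite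
      horizon that probability is bounded by the chance of hitting \<open>A\<close>.\<close>
    have "1 \<le> hit_prob ?K A z"
      unfolding flag_hit[OF z, symmetric] hit_prob_def[of ?F]
      by (intro SUP_least hit_within_flag_le_hit_prob[OF A(1) M.AE_hit_prob_eq_1[OF assms(2) A] z])
    then have "hit_prob ?K A z = 1"
      using M.hit_prob_le_1[OF z] by (simp add: antisym)
    then show ?thesis
      using law(4) by (simp add: law.emeasure_eq_measure)
  qed
  then show ?thesis
    using assms(2) mcmc_kernel_stationary by (simp add: harris_recurrent_def)
qed

end
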